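(* Let $n$ be a positive integer. Assume that (the image of) $B_n^{(1,2)}$ is a $\mathbb{C}$-vector space basis of $R_n^{(1,2)}$. Then the Hilbert series of $R_n^{(1,2)}$ is $$\mathrm{Hilb}(R_n^{(1,2)};q;u,v)=\sum_{\pi\in\Pi(n)_{>0}}u^{\deg_\theta(\pi)}\,v^{\deg_\xi(\pi)}\,\mathrm{stair}_q(\pi).$$
   Context: **The ring.** Let $\mathbb{C}[\boldsymbol{x}_n,\boldsymbol\theta_n,\boldsymbol\xi_n]$ be the algebra generated by commuting variables $x_1,\ldots,x_n$ (commuting with all variables) and variables $\theta_1,\ldots,\theta_n,\xi_1,\ldots,\xi_n$ which all anticommute with one another (so square to zero). The symmetric group $\mathfrak{S}_n$ acts diagonally by permuting the indices. $R_n^{(1,2)}$ is the quotient by the ideal generated by all $\mathfrak{S}_n$-invariant elements with zero constant term. It is graded by $x$-degree, $\theta$-degree and $\xi$-degree, and $\mathrm{Hilb}(R_n^{(1,2)};q;u,v)=\sum_{a,b,c}\dim\big((R_n^{(1,2)})_{a,b,c}\big)q^au^bv^c$, where $(R_n^{(1,2)})_{a,b,c}$ is the component of $x$-degree $a$, $\theta$-degree $b$, $\xi$-degree $c$. **Paths and $B_n^{(1,2)}$.** $\Pi(n)_{>0}$ is the set of modified Motzkin paths of length $n$: lattice paths $\pi=(p_1,\ldots,p_n)$ in $\mathbb{Z}^2$ starting at $(0,0)$ whose $i$-th step $p_i$ is one of: an (undecorated) up-step $(1,1)$; a horizontal step $(1,0)$ with decoration $\theta_i$; a horizontal step $(1,0)$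 with decoration $\xi_i$; a down-step $(1,-1)$ with decoration $\theta_i\xi_i$; such that the first step is an up-step and afterwards the path never goes below the line $y=1$. Let $T(\pi)$ (resp. $S(\pi)$) be the set of indices $i$ such that $\theta_i$ (resp. $\xi_i$) occurs in the decoration of $p_i$ (subsets of $\{2,\ldots,n\}$), and $\deg_\theta(\pi)=|T(\pi)|$, $\deg_\xi(\pi)=|S(\pi)|$. For $T,S\subseteq\{2,\ldots,n\}$ define $\alpha(T,S)$ by $\alpha_1(T,S)=0$ and, for $2\le i\le n$, $\alpha_i(T,S)=\alpha_{i-1}(T,S)-1+\chi(i\notin T)+\chi(i\notin S)$, where $\chi(P)=1$ if $P$ is true and $0$ otherwise. $B_n^{(1,2)}$ is the set of monomials $x^\alpha\theta_T\xi_S$ ($\theta_T,\xi_S$ the products in increasing order of indices; signs irrelevant) such that $(T,S)=(T(\pi),S(\pi))$ for some $\pi\in\Pi(n)_{>0}$ and $0\le\alpha_i\le\alpha_i(T,S)$ for all $i$. With $[m]_q=1+q+\cdots+q^{m-1}$, $\mathrm{stair}_q(\pi)=\prod_{i=1}^n[\alpha_i(T(\pi),S(\pi))+1]_q$. *)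

theory Defs
  imports
    "HOL-Algebra.Embedded_Algebras"
    "HOL-Algebra.QuotRing"
    "HOL-Combinatorics.Permutations"
    "HOL-Computational_Algebra.Formal_Power_Series"
    "HOL-Library.Product_Plus"
begin

section \<open>The superspace ring and its diagonal coinvariants\<close>

subsection \<open>The free algebra\<close>

datatype var = X nat | Theta nat | Xi nat

definition vars :: "nat \<Rightarrow> var set"
  where "vars n = X ` {1..n} \<union> Theta ` {1..n} \<union> Xi ` {1..n}"

definition odd_vars :: "nat \<Rightarrow> var set"
  where "odd_vars n = Theta ` {1..n} \<union> Xi ` {1..n}"

text \<open>The free associative complex algebra on the given variables. An element is its coefficient
  function on words, so multiplication is convolution along concatenation of words.\<close>

definition free_alg :: "nat \<Rightarrow> (var list \<Rightarrow> complex) ring"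
  where "free_alg n =
    \<lparr>carrier = {f. finite {w. f w \<noteq> 0} \<and> {w. f w \<noteq> 0} \<subseteq> lists (vars n)},
     monoid.mult = (\<lambda>f g w. \<Sum>k\<le>length w. f (take k w) * g (drop k w)),
     one = (\<lambda>w. of_bool (w = [])),
     zero = (\<lambda>w. 0),
     add = (\<lambda>f g w. f w + g w)\<rparr>"

definition word :: "var list \<Rightarrow> var list \<Rightarrow> complex"
  where "word u = (\<lambda>w. of_bool (w = u))"

definition const :: "complex \<Rightarrow> var list \<Rightarrow> complex"
  where "const c = (\<lambda>w. if w = [] then c else 0)"

lemma free_alg_simps:
  "carrier (free_alg n) = {f. finite {w. f w \<noteq> 0} \<and> {w. f w \<noteq> 0} \<subseteq> lists (vars n)}"
  "f \<otimes>\<^bsub>free_alg n\<^esub> g = (\<lambda>w. \<Sum>k\<le>length w. f (take k w) * g (drop k w))"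
  "\<one>\<^bsub>free_alg n\<^esub> = (\<lambda>w. of_bool (w = []))"
  "\<zero>\<^bsub>free_alg n\<^esub> = (\<lambda>w. 0)"
  "f \<oplus>\<^bsub>free_alg n\<^esub> g = (\<lambda>w. f w + g w)"
  by (simp_all add: free_alg_def)

lemma free_alg_mult_closed:
  assumes "f \<in> carrier (free_alg n)" "g \<in> carrier (free_alg n)"
  shows "f \<otimes>\<^bsub>free_alg n\<^esub> g \<in> carrier (free_alg n)"
proof -
  let ?F = "{w. f w \<noteq> 0}" and ?G = "{w. g w \<noteq> 0}"
  let ?P = "(\<lambda>(u, v). u @ v) ` (?F \<times> ?G)"
  have sub: "{w. (f \<otimes>\<^bsub>free_alg n\<^esub> g) w \<noteq> 0} \<subseteq> ?P"
  proof
    fix w assume "w \<in> {w. (f \<otimes>\<^bsub>free_alg n\<^esub> g) w \<noteq> 0}"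
    then have "(\<Sum>k\<le>length w. f (take k w) * g (drop k w)) \<noteq> 0"
      by (simp add: free_alg_simps(2))
    then obtain k where "f (take k w) * g (drop k w) \<noteq> 0"
      by (rule sum.not_neutral_contains_not_neutral)
    then have "(take k w, drop k w) \<in> ?F \<times> ?G" by simp
    then have "(\<lambda>(u, v). u @ v) (take k w, drop k w) \<in> ?P" by (rule imageI)
    then show "w \<in> ?P" by simp
  qed
  have F: "finite ?F" "?F \<subseteq> lists (vars n)" and G: "finite ?G" "?G \<subseteq> lists (vars n)"
    using assms by (simp_all only: free_alg_simps(1) mem_Collect_eq)
  have "finite ?P" using F(1) G(1) by (intro finite_imageI finite_cartesian_product)
  moreover have "?P \<subseteq> lists (vars n)"
  proof (rule image_subsetI)
    fix p assume "p \<in> ?F \<times> ?G"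
    then have "fst p \<in> lists (vars n)" "snd p \<in> lists (vars n)"
      using F(2) G(2) by (auto simp only: mem_Times_iff)
    then show "(case p of (u, v) \<Rightarrow> u @ v) \<in> lists (vars n)"
      by (simp add: case_prod_beta)
  qed
  ultimately show ?thesis
    unfolding free_alg_simps(1) mem_Collect_eq
    using finite_subset[OF sub] subset_trans[OF sub] by (intro conjI)
qed

lemma free_alg_mult_assoc:
  "(f \<otimes>\<^bsub>free_alg n\<^esub> g) \<otimes>\<^bsub>free_alg n\<^esub> h = f \<otimes>\<^bsub>free_alg n\<^esub> (g \<otimes>\<^bsub>free_alg n\<^esub> h)"
proof
  fix w :: "var list"
  let ?L = "length w"
  let ?t = "\<lambda>j m. f (take j w) * g (take m (drop j w)) * h (drop (j + m) w)"
  have "((f \<otimes>\<^bsub>free_alg n\<^esub> g) \<otimes>\<^bsub>free_alg n\<^esub> h) w = (\<Sum>k\<le>?L. \<Sum>j\<le>k. ?t j (k - j))"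
    unfolding free_alg_simps sum_distrib_right
    by (intro sum.cong refl) (auto simp: min_def take_drop)
  also have "\<dots> = (\<Sum>(j, m) \<in> {(j, m). j + m \<le> ?L}. ?t j m)"
    by (simp add: sum.triangle_reindex_eq)
  also have "{(j, m). j + m \<le> ?L} = (SIGMA j:{..?L}. {..?L - j})"
    by auto
  also have "(\<Sum>(j, m) \<in> \<dots>. ?t j m) = (\<Sum>j\<le>?L. \<Sum>m\<le>?L - j. ?t j m)"
    by (simp add: sum.Sigma)
  also have "\<dots> = (f \<otimes>\<^bsub>free_alg n\<^esub> (g \<otimes>\<^bsub>free_alg n\<^esub> h)) w"
    unfolding free_alg_simps sum_distrib_left
    by (intro sum.cong refl) (auto simp: add.commute mult.assoc)
  finally show "((f \<otimes>\<^bsub>free_alg n\<^esub> g) \<otimes>\<^bsub>free_alg n\<^esub> h) w = (f \<otimes>\<^bsub>free_alg n\<^esub> (g \<otimes>\<^bsub>free_alg n\<^esub> h)) w" .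
qed

lemma free_alg_one_mult:
  "\<one>\<^bsub>free_alg n\<^esub> \<otimes>\<^bsub>free_alg n\<^esub> f = f" "f \<otimes>\<^bsub>free_alg n\<^esub> \<one>\<^bsub>free_alg n\<^esub> = f"
proof -
  show "\<one>\<^bsub>free_alg n\<^esub> \<otimes>\<^bsub>free_alg n\<^esub> f = f"
  proof
    fix w
    have "(\<one>\<^bsub>free_alg n\<^esub> \<otimes>\<^bsub>free_alg n\<^esub> f) w = (\<Sum>k\<le>length w. if k = 0 then f w else 0)"
      unfolding free_alg_simps by (intro sum.cong refl) auto
    then show "(\<one>\<^bsub>free_alg n\<^esub> \<otimes>\<^bsub>free_alg n\<^esub> f) w = f w" by simp
  qed
  show "f \<otimes>\<^bsub>free_alg n\<^esub> \<one>\<^bsub>free_alg n\<^esub> = f"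
  proof
    fix w
    have "(f \<otimes>\<^bsub>free_alg n\<^esub> \<one>\<^bsub>free_alg n\<^esub>) w = (\<Sum>k\<le>length w. if k = length w then f w else 0)"
      unfolding free_alg_simps by (intro sum.cong refl) auto
    then show "(f \<otimes>\<^bsub>free_alg n\<^esub> \<one>\<^bsub>free_alg n\<^esub>) w = f w" by simp
  qed
qed

lemma ring_free_alg: "ring (free_alg n)"
proof (rule ringI)
  show "abelian_group (free_alg n)"
  proof (rule abelian_groupI)
    fix f g assume "f \<in> carrier (free_alg n)" "g \<in> carrier (free_alg n)"
    moreover have "{w. f w + g w \<noteq> 0} \<subseteq> {w. f w \<noteq> 0} \<union> {w. g w \<noteq> 0}" by auto
    ultimately show "f \<oplus>\<^bsub>free_alg n\<^esub> g \<in> carrier (free_alg n)"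
      unfolding free_alg_simps(1,5) mem_Collect_eq
      by (intro conjI) (rule finite_subset, assumption, simp, rule subset_trans, assumption, simp)
  next
    show "\<zero>\<^bsub>free_alg n\<^esub> \<in> carrier (free_alg n)"
      by (simp add: free_alg_simps(1,4))
  next
    fix f g h :: "var list \<Rightarrow> complex"
    show "f \<oplus>\<^bsub>free_alg n\<^esub> g \<oplus>\<^bsub>free_alg n\<^esub> h = f \<oplus>\<^bsub>free_alg n\<^esub> (g \<oplus>\<^bsub>free_alg n\<^esub> h)"
      "f \<oplus>\<^bsub>free_alg n\<^esub> g = g \<oplus>\<^bsub>free_alg n\<^esub> f" "\<zero>\<^bsub>free_alg n\<^esub> \<oplus>\<^bsub>free_alg n\<^esub> f = f"
      by (simp_all add: free_alg_simps(4,5) add_ac)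
  next
    fix f assume "f \<in> carrier (free_alg n)"
    then show "\<exists>g\<in>carrier (free_alg n). g \<oplus>\<^bsub>free_alg n\<^esub> f = \<zero>\<^bsub>free_alg n\<^esub>"
      by (intro bexI[of _ "\<lambda>w. - f w"]) (simp_all add: free_alg_simps(1,4,5))
  qed
next
  show "Group.monoid (free_alg n)"
  proof (rule monoidI)
    show "\<one>\<^bsub>free_alg n\<^esub> \<in> carrier (free_alg n)"
      by (simp add: free_alg_simps(1,3))
  qed (simp_all only: free_alg_mult_closed free_alg_mult_assoc free_alg_one_mult)
next
  fix f g h :: "var list \<Rightarrow> complex"
  show "(f \<oplus>\<^bsub>free_alg n\<^esub> g) \<otimes>\<^bsub>free_alg n\<^esub> h =
      f \<otimes>\<^bsub>free_alg n\<^esub> h \<oplus>\<^bsub>free_alg n\<^esub> g \<otimes>\<^bsub>free_alg n\<^esub> h"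
    by (simp only: free_alg_simps distrib_right sum.distrib)
  show "h \<otimes>\<^bsub>free_alg n\<^esub> (f \<oplus>\<^bsub>free_alg n\<^esub> g) =
      h \<otimes>\<^bsub>free_alg n\<^esub> f \<oplus>\<^bsub>free_alg n\<^esub> h \<otimes>\<^bsub>free_alg n\<^esub> g"
    by (simp only: free_alg_simps distrib_left sum.distrib)
qed

subsection \<open>Commuting and anticommuting variables\<close>

text \<open>Taking \<open>a = b\<close> in the second family gives \<open>2 a\<^sup>2 = 0\<close>.\<close>

definition super_rels :: "nat \<Rightarrow> (var list \<Rightarrow> complex) set"
  where "super_rels n =
    {word [X i, v] \<ominus>\<^bsub>free_alg n\<^esub> word [v, X i] | i v. i \<in> {1..n} \<and> v \<in> vars n} \<union>
    {word [a, b] \<oplus>\<^bsub>free_alg n\<^esub> word [b, a] | a b. a \<in> odd_vars n \<and> b \<in> odd_vars n}"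

definition super_ideal :: "nat \<Rightarrow> (var list \<Rightarrow> complex) set"
  where "super_ideal n = Idl\<^bsub>free_alg n\<^esub> (super_rels n)"

definition super_alg :: "nat \<Rightarrow> (var list \<Rightarrow> complex) set ring"
  where "super_alg n = free_alg n Quot super_ideal n"

definition super_class :: "nat \<Rightarrow> (var list \<Rightarrow> complex) \<Rightarrow> (var list \<Rightarrow> complex) set"
  where "super_class n f = super_ideal n +>\<^bsub>free_alg n\<^esub> f"

lemma word_closed: "w \<in> lists (vars n) \<Longrightarrow> word w \<in> carrier (free_alg n)"
  by (simp add: free_alg_simps(1) word_def)

lemma super_rels_subset: "super_rels n \<subseteq> carrier (free_alg n)"
proof -
  interpret ring "free_alg n" by (rule ring_free_alg)
  have X: "X i \<in> vars n" if "i \<in> {1..n}" for i using that by (simp add: vars_def)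
  have odd: "a \<in> vars n" if "a \<in> odd_vars n" for a
    using that unfolding vars_def odd_vars_def by blast
  have word2: "word [a, b] \<in> carrier (free_alg n)" if "a \<in> vars n" "b \<in> vars n" for a b
    using that by (intro word_closed) simp
  show ?thesis
  proof
    fix r assume "r \<in> super_rels n"
    then consider
      i v where "i \<in> {1..n}" "v \<in> vars n"
        "r = word [X i, v] \<ominus>\<^bsub>free_alg n\<^esub> word [v, X i]"
      | a b where "a \<in> odd_vars n" "b \<in> odd_vars n"
        "r = word [a, b] \<oplus>\<^bsub>free_alg n\<^esub> word [b, a]"
      unfolding super_rels_def by blast
    then show "r \<in> carrier (free_alg n)"
      by cases (simp_all only: minus_closed a_closed word2 X odd)
  qed
qed

lemma ideal_super_ideal: "ideal (super_ideal n) (free_alg n)"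
  unfolding super_ideal_def by (rule ring.genideal_ideal[OF ring_free_alg super_rels_subset])

lemma ring_super_alg: "ring (super_alg n)"
  unfolding super_alg_def by (rule ideal.quotient_is_ring[OF ideal_super_ideal])

subsection \<open>Diagonal action and coinvariants\<close>

definition perm_var :: "(nat \<Rightarrow> nat) \<Rightarrow> var \<Rightarrow> var"
  where "perm_var \<sigma> v = (case v of X i \<Rightarrow> X (\<sigma> i) | Theta i \<Rightarrow> Theta (\<sigma> i) | Xi i \<Rightarrow> Xi (\<sigma> i))"

text \<open>Substituting \<open>perm_var \<sigma> v\<close> for every variable \<open>v\<close>. The relations are stable under this, so
  it acts on \<^term>\<open>super_alg n\<close> by taking images of cosets.\<close>

definition perm_free :: "(nat \<Rightarrow> nat) \<Rightarrow> (var list \<Rightarrow> complex) \<Rightarrow> var list \<Rightarrow> complex"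
  where "perm_free \<sigma> f = (\<lambda>w. f (map (perm_var (inv_into UNIV \<sigma>)) w))"

lemma perm_free_word:
  assumes "bij \<sigma>"
  shows "perm_free \<sigma> (word u) = word (map (perm_var \<sigma>) u)"
proof -
  have inv: "inv_into UNIV \<sigma> (\<sigma> i) = i" "\<sigma> (inv_into UNIV \<sigma> i) = i" for i
    using assms by (simp_all add: bij_is_inj bij_is_surj surj_f_inv_f)
  have "perm_var (inv_into UNIV \<sigma>) (perm_var \<sigma> v) = v"
    "perm_var \<sigma> (perm_var (inv_into UNIV \<sigma>) v) = v" for v
    by (cases v; simp add: perm_var_def inv)+
  then have "map (perm_var (inv_into UNIV \<sigma>)) (map (perm_var \<sigma>) u) = u"
    "map (perm_var \<sigma>) (map (perm_var (inv_into UNIV \<sigma>)) w) = w" for w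
    by (simp_all add: map_idI)
  then have "map (perm_var (inv_into UNIV \<sigma>)) w = u \<longleftrightarrow> w = map (perm_var \<sigma>) u" for w
    by metis
  then show ?thesis by (simp add: perm_free_def word_def)
qed

definition perm_act :: "(nat \<Rightarrow> nat) \<Rightarrow> (var list \<Rightarrow> complex) set \<Rightarrow> (var list \<Rightarrow> complex) set"
  where "perm_act \<sigma> a = perm_free \<sigma> ` a"

text \<open>The relations have no terms of length below two, so all representatives of a class have the
  same coefficient at the empty word, namely the constant term of the class.\<close>

definition positive_invariants :: "nat \<Rightarrow> (var list \<Rightarrow> complex) set set"
  where "positive_invariants n =
    {a \<in> carrier (super_alg n). (\<forall>\<sigma>. \<sigma> permutes {1..n} \<longrightarrow> perm_act \<sigma> a = a) \<and> (\<forall>f\<in>a. f [] = 0)}"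

definition invariant_ideal :: "nat \<Rightarrow> (var list \<Rightarrow> complex) set set"
  where "invariant_ideal n = Idl\<^bsub>super_alg n\<^esub> (positive_invariants n)"

definition coinv :: "nat \<Rightarrow> (var list \<Rightarrow> complex) set set ring"
  where "coinv n = super_alg n Quot invariant_ideal n"

definition coinv_class :: "nat \<Rightarrow> (var list \<Rightarrow> complex) set \<Rightarrow> (var list \<Rightarrow> complex) set set"
  where "coinv_class n a = invariant_ideal n +>\<^bsub>super_alg n\<^esub> a"

lemma ideal_invariant_ideal: "ideal (invariant_ideal n) (super_alg n)"
  unfolding invariant_ideal_def
  by (rule ring.genideal_ideal[OF ring_super_alg]) (auto simp: positive_invariants_def)

lemma ring_coinv: "ring (coinv n)"
  unfolding coinv_def by (rule ideal.quotient_is_ring[OF ideal_invariant_ideal])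

text \<open>The copy of the complex numbers in the quotient; linear algebra over it is that of
  \<^theory>\<open>HOL-Algebra.Embedded_Algebras\<close>.\<close>

definition coinv_scalars :: "nat \<Rightarrow> (var list \<Rightarrow> complex) set set set"
  where "coinv_scalars n = range (\<lambda>c. coinv_class n (super_class n (const c)))"

subsection \<open>Grading and Hilbert series\<close>

definition x_deg :: "var list \<Rightarrow> nat"
  where "x_deg w = length (filter (\<lambda>v. v \<in> range X) w)"

definition theta_deg :: "var list \<Rightarrow> nat"
  where "theta_deg w = length (filter (\<lambda>v. v \<in> range Theta) w)"

definition xi_deg :: "var list \<Rightarrow> nat"
  where "xi_deg w = length (filter (\<lambda>v. v \<in> range Xi) w)"

definition free_component :: "nat \<Rightarrow> nat \<Rightarrow> nat \<Rightarrow> nat \<Rightarrow> (var list \<Rightarrow> complex) set"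
  where "free_component n a b c =
    {f \<in> carrier (free_alg n). \<forall>w. f w \<noteq> 0 \<longrightarrow> x_deg w = a \<and> theta_deg w = b \<and> xi_deg w = c}"

definition coinv_component :: "nat \<Rightarrow> nat \<Rightarrow> nat \<Rightarrow> nat \<Rightarrow> (var list \<Rightarrow> complex) set set set"
  where "coinv_component n a b c = (coinv_class n \<circ> super_class n) ` free_component n a b c"

text \<open>Formal power series in three variables are nested: innermost in \<open>q\<close>, then \<open>u\<close>, then \<open>v\<close>.\<close>

definition qvar :: "int fps fps fps" where "qvar = fps_const (fps_const fps_X)"
definition uvar :: "int fps fps fps" where "uvar = fps_const fps_X"
definition vvar :: "int fps fps fps" where "vvar = fps_X"

definition Hilb :: "nat \<Rightarrow> int fps fps fps"
  where "Hilb n = Abs_fps (\<lambda>c. Abs_fps (\<lambda>b. Abs_fps (\<lambda>a.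
    int (ring.dim (coinv n) (coinv_scalars n) (coinv_component n a b c)))))"

section \<open>Modified Motzkin paths\<close>

datatype step = Up | HorTheta | HorXi | Down

fun step_vec :: "step \<Rightarrow> int \<times> int"
  where
    "step_vec Up = (1, 1)"
  | "step_vec HorTheta = (1, 0)"
  | "step_vec HorXi = (1, 0)"
  | "step_vec Down = (1, -1)"

text \<open>The decoration carried by the \<open>i\<close>-th step.\<close>

fun decoration :: "nat \<Rightarrow> step \<Rightarrow> var set"
  where
    "decoration i Up = {}"
  | "decoration i HorTheta = {Theta i}"
  | "decoration i HorXi = {Xi i}"
  | "decoration i Down = {Theta i, Xi i}"

text \<open>Steps are numbered from 1: the \<open>i\<close>-th step is \<open>\<pi> ! (i - 1)\<close>, and \<open>path_point \<pi> i\<close> is the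
  lattice point reached after it.\<close>

definition path_point :: "step list \<Rightarrow> nat \<Rightarrow> int \<times> int"
  where "path_point \<pi> i = sum_list (map step_vec (take i \<pi>))"

definition motzkin_paths :: "nat \<Rightarrow> step list set"
  where "motzkin_paths n =
    {\<pi>. length \<pi> = n \<and> \<pi> ! 0 = Up \<and> (\<forall>i\<in>{1..n}. snd (path_point \<pi> i) \<ge> 1)}"

definition T_set :: "step list \<Rightarrow> nat set"
  where "T_set \<pi> = {i \<in> {1..length \<pi>}. Theta i \<in> decoration i (\<pi> ! (i - 1))}"

definition S_set :: "step list \<Rightarrow> nat set"
  where "S_set \<pi> = {i \<in> {1..length \<pi>}. Xi i \<in> decoration i (\<pi> ! (i - 1))}"

definition deg_theta :: "step list \<Rightarrow> nat" where "deg_theta \<pi> = card (T_set \<pi>)"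
definition deg_xi :: "step list \<Rightarrow> nat" where "deg_xi \<pi> = card (S_set \<pi>)"

text \<open>Only the values at positive indices are meaningful.\<close>

fun stair_exp :: "nat set \<Rightarrow> nat set \<Rightarrow> nat \<Rightarrow> int"
  where
    "stair_exp T S 0 = 0"
  | "stair_exp T S (Suc 0) = 0"
  | "stair_exp T S (Suc (Suc i)) =
      stair_exp T S (Suc i) - 1 + of_bool (Suc (Suc i) \<notin> T) + of_bool (Suc (Suc i) \<notin> S)"

definition q_int :: "nat \<Rightarrow> int fps fps fps"
  where "q_int m = (\<Sum>k<m. qvar ^ k)"

definition stair_q :: "step list \<Rightarrow> int fps fps fps"
  where "stair_q \<pi> = (\<Prod>i=1..length \<pi>. q_int (nat (stair_exp (T_set \<pi>) (S_set \<pi>) i + 1)))"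

lemma finite_motzkin_paths: "finite (motzkin_paths n)"
proof (rule finite_subset)
  show "motzkin_paths n \<subseteq> {\<pi>. set \<pi> \<subseteq> {Up, HorTheta, HorXi, Down} \<and> length \<pi> = n}"
    by (auto simp: motzkin_paths_def intro: step.exhaust)
  show "finite {\<pi>. set \<pi> \<subseteq> {Up, HorTheta, HorXi, Down} \<and> length \<pi> = n}"
    by (rule finite_lists_length_eq) simp
qed

section \<open>The monomials\<close>

text \<open>The class of \<open>x\<^sup>\<alpha> \<theta>\<^sub>T \<xi>\<^sub>S\<close>, with \<open>\<theta>\<^sub>T\<close> and \<open>\<xi>\<^sub>S\<close> multiplied in increasing order of indices.\<close>

definition super_monomial ::
  "nat \<Rightarrow> (nat \<Rightarrow> nat) \<Rightarrow> nat set \<Rightarrow> nat set \<Rightarrow> (var list \<Rightarrow> complex) set"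
  where "super_monomial n \<alpha> T S = super_class n (word
    (concat (map (\<lambda>i. replicate (\<alpha> i) (X i)) [1..<Suc n]) @
     map Theta (sorted_list_of_set T) @ map Xi (sorted_list_of_set S)))"

definition B_set :: "nat \<Rightarrow> (var list \<Rightarrow> complex) set set"
  where "B_set n = {super_monomial n \<alpha> T S | \<alpha> T S.
    (\<exists>\<pi>\<in>motzkin_paths n. T = T_set \<pi> \<and> S = S_set \<pi>) \<and>
    (\<forall>i\<in>{1..n}. int (\<alpha> i) \<le> stair_exp T S i)}"

text \<open>The image of a (finite) set of elements in the coinvariant ring is a basis: for a repetition-free
  enumeration of the set, the family of images is linearly independent and spans. In particular
  distinct elements have distinct images.\<close>

definition image_is_basis :: "nat \<Rightarrow> (var list \<Rightarrow> complex) set set \<Rightarrow> bool"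
  where "image_is_basis n B \<longleftrightarrow>
    (\<exists>bs. distinct bs \<and> set bs = B \<and>
      ring.independent (coinv n) (coinv_scalars n) (map (coinv_class n) bs) \<and>
      ring.Span (coinv n) (coinv_scalars n) (map (coinv_class n) bs) = carrier (coinv n))"

end

theory Submission
  imports Defs
begin

text \<open>The ideal of the coinvariant ring, pulled back to the free algebra, is homogeneous for the
  tridegree, because permuting the indices preserves tridegrees. Hence the tridegree \<open>(a, b, c)\<close> part
  of the expansion of an element of \<open>(R\<^sub>n)\<^sub>a\<^sub>,\<^sub>b\<^sub>,\<^sub>c\<close> in a basis of monomials still represents
  it, so that component has as basis the basis monomials of tridegree \<open>(a, b, c)\<close>. It remains to
  count these: expanding the product of \<open>q\<close>-integers over the exponent vectors shows that
  \<open>stair\<^sub>q(\<pi>)\<close> enumerates the admissible exponents of \<open>\<pi>\<close>, and a path is determined by its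
  sets \<open>T\<close> and \<open>S\<close>. Different index triples give different elements of the superspace ring:
  the defining relations are homogeneous for the full multidegree, so two equal monomials of different
  multidegree would both vanish, contradicting linear independence.\<close>

section \<open>Homogeneous ideals of the free algebra\<close>

lemma free_alg_a_inv:
  assumes "f \<in> carrier (free_alg n)"
  shows "\<ominus>\<^bsub>free_alg n\<^esub> f = (\<lambda>w. - f w)"
proof -
  interpret ring "free_alg n" by (rule ring_free_alg)
  show ?thesis
    using assms by (intro minus_equality) (auto simp: free_alg_simps(1,4,5))
qed

lemma free_alg_minus:
  assumes "f \<in> carrier (free_alg n)" "g \<in> carrier (free_alg n)"
  shows "f \<ominus>\<^bsub>free_alg n\<^esub> g = (\<lambda>w. f w - g w)"
  using assms by (simp add: a_minus_def free_alg_a_inv free_alg_simps(5))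

text \<open>The homogeneous component of degree \<open>d\<close>. The degree map is a parameter
  because two gradings are used: \<open>tri_deg\<close> for the coinvariant ideal and
  \<open>mset\<close>, the full multidegree, for telling monomials apart.\<close>

definition proj :: "(var list \<Rightarrow> 'd) \<Rightarrow> 'd \<Rightarrow> (var list \<Rightarrow> complex) \<Rightarrow> var list \<Rightarrow> complex"
  where "proj dg d f = (\<lambda>w. if dg w = d then f w else 0)"

lemma proj_closed:
  assumes "f \<in> carrier (free_alg n)"
  shows "proj dg d f \<in> carrier (free_alg n)"
proof -
  have "{w. proj dg d f w \<noteq> 0} \<subseteq> {w. f w \<noteq> 0}"
    by (auto simp: proj_def)
  moreover have "finite {w. f w \<noteq> 0}" "{w. f w \<noteq> 0} \<subseteq> lists (vars n)"
    using assms by (simp_all only: free_alg_simps(1) mem_Collect_eq)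
  ultimately show ?thesis
    unfolding free_alg_simps(1) mem_Collect_eq
    by (intro conjI) (rule finite_subset, assumption+, rule subset_trans)
qed

lemma proj_add: "proj dg d (f \<oplus>\<^bsub>free_alg n\<^esub> g) = proj dg d f \<oplus>\<^bsub>free_alg n\<^esub> proj dg d g"
  by (auto simp: free_alg_simps(5) proj_def)

lemma proj_diff: "proj dg d (\<lambda>w. f w - g w) = (\<lambda>w. proj dg d f w - proj dg d g w)"
  by (auto simp: proj_def)

lemma proj_word: "proj dg d (word u) = (if dg u = d then word u else \<zero>\<^bsub>free_alg n\<^esub>)"
  by (auto simp: free_alg_simps(4) proj_def word_def)

lemmas ideal_add = additive_subgroup.a_closed[OF ideal.axioms(1)]
lemmas ideal_zero = additive_subgroup.zero_closed[OF ideal.axioms(1)]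
lemmas ideal_carrier = additive_subgroup.a_Hcarr[OF ideal.axioms(1)]
lemmas ideal_neg = additive_subgroup.a_inv_closed[OF ideal.axioms(1)]

lemma ideal_minus_mem:
  assumes "ideal I (free_alg n)" "f \<in> I" "g \<in> I"
  shows "(\<lambda>w. f w - g w) \<in> I"
proof -
  have "f \<ominus>\<^bsub>free_alg n\<^esub> g \<in> I"
    unfolding a_minus_def by (intro ideal_add ideal_neg assms)
  then show ?thesis
    using assms(2,3)[THEN ideal_carrier[OF assms(1)]] by (simp only: free_alg_minus)
qed

lemma ideal_sum_mem:
  assumes I: "ideal I (free_alg n)" and "finite A" "\<And>i. i \<in> A \<Longrightarrow> F i \<in> I"
  shows "(\<lambda>w. \<Sum>i\<in>A. F i w) \<in> I"
  using assms(2,3)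
proof (induction A rule: finite_induct)
  case empty
  show ?case
    using ideal_zero[OF I] by (simp add: free_alg_simps(4))
next
  case (insert x A)
  then have "F x \<oplus>\<^bsub>free_alg n\<^esub> (\<lambda>w. \<Sum>i\<in>A. F i w) \<in> I"
    by (intro ideal_add[OF I]) auto
  with insert show ?case by (simp add: free_alg_simps(5))
qed

definition additive_deg :: "(var list \<Rightarrow> 'd::comm_monoid_add) \<Rightarrow> bool"
  where "additive_deg dg \<longleftrightarrow> (\<forall>u v. dg (u @ v) = dg u + dg v)"

lemma finite_deg_pairs:
  assumes "f \<in> carrier (free_alg n)" "g \<in> carrier (free_alg n)"
  shows "finite {(a, b). a \<in> dg ` {w. f w \<noteq> 0} \<and> b \<in> dg ` {w. g w \<noteq> 0} \<and> a + b = d}"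
proof (rule finite_subset)
  show "finite (dg ` {w. f w \<noteq> 0} \<times> dg ` {w. g w \<noteq> 0})"
    using assms by (simp add: free_alg_simps(1))
qed blast

text \<open>The product is a sum over all cuts of a word into prefix and suffix, and a cut splits
  the degree additively. Grouping cuts by their pair of degrees gives the formula. Restricting to
  degrees that occur in \<open>f\<close> and \<open>g\<close> keeps the sum finite, since in a
  general monoid \<open>d\<close> can have infinitely many splittings.\<close>

lemma proj_mult:
  assumes "additive_deg dg" "f \<in> carrier (free_alg n)" "g \<in> carrier (free_alg n)"
  shows "proj dg d (f \<otimes>\<^bsub>free_alg n\<^esub> g) =
    (\<lambda>w. \<Sum>(a, b) \<in> {(a, b). a \<in> dg ` {w. f w \<noteq> 0} \<and> b \<in> dg ` {w. g w \<noteq> 0} \<and> a + b = d}.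
      (proj dg a f \<otimes>\<^bsub>free_alg n\<^esub> proj dg b g) w)"
    (is "_ = (\<lambda>w. \<Sum>(a, b) \<in> ?D. _ a b w)")
proof
  fix w
  have fin: "finite ?D" by (rule finite_deg_pairs[OF assms(2,3)])
  have dg: "dg w = dg (take k w) + dg (drop k w)" for k
    using assms(1) unfolding additive_deg_def by (metis append_take_drop_id)
  have "(\<Sum>(a, b)\<in>?D. (proj dg a f \<otimes>\<^bsub>free_alg n\<^esub> proj dg b g) w) =
    (\<Sum>k\<le>length w. \<Sum>(a, b)\<in>?D. proj dg a f (take k w) * proj dg b g (drop k w))"
    unfolding free_alg_simps(2) case_prod_unfold by (rule sum.swap)
  also have "\<dots> = (\<Sum>k\<le>length w. if dg w = d then f (take k w) * g (drop k w) else 0)"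
  proof (rule sum.cong[OF refl])
    fix k
    let ?p = "(dg (take k w), dg (drop k w))"
    \<comment> \<open>A nonzero term puts both pieces of the word in the supports, so their pair of
      degrees is listed as soon as it adds up to \<open>d\<close>. A zero term contributes nothing
      on either side.\<close>
    have mem: "?p \<in> ?D \<longleftrightarrow> dg w = d" if "f (take k w) * g (drop k w) \<noteq> 0"
      using that by (auto simp: dg[of k])
    have "(\<Sum>(a, b)\<in>?D. proj dg a f (take k w) * proj dg b g (drop k w)) =
      (\<Sum>p\<in>?D. if p = ?p then f (take k w) * g (drop k w) else 0)"
      by (rule sum.cong[OF refl]) (simp only: proj_def case_prod_unfold prod_eq_iff fst_conv snd_conv, simp)
    also have "\<dots> = (if ?p \<in> ?D then f (take k w) * g (drop k w) else 0)"
      using fin by simp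
    also have "\<dots> = (if dg w = d then f (take k w) * g (drop k w) else 0)"
      using mem by (cases "f (take k w) * g (drop k w) = 0") simp_all
    finally show "(\<Sum>(a, b)\<in>?D. proj dg a f (take k w) * proj dg b g (drop k w)) = \<dots>" .
  qed
  also have "\<dots> = proj dg d (f \<otimes>\<^bsub>free_alg n\<^esub> g) w"
    by (simp add: proj_def free_alg_simps(2))
  finally show "proj dg d (f \<otimes>\<^bsub>free_alg n\<^esub> g) w =
    (\<Sum>(a, b)\<in>?D. (proj dg a f \<otimes>\<^bsub>free_alg n\<^esub> proj dg b g) w)" by simp
qed

text \<open>For an additive degree and an ideal \<open>I\<close>, this is the largest homogeneous
  ideal inside \<open>I\<close>.\<close>

definition homogeneous_core ::
  "nat \<Rightarrow> (var list \<Rightarrow> 'd) \<Rightarrow> (var list \<Rightarrow> complex) set \<Rightarrow> (var list \<Rightarrow> complex) set"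
  where "homogeneous_core n dg I = {f \<in> carrier (free_alg n). \<forall>d. proj dg d f \<in> I}"

text \<open>This reduces homogeneity of a generated ideal to its generators: once they lie in the
  core, the whole ideal does by minimality. Closure under multiplication holds because a component
  of a product is a finite sum of products of components, each with a factor in
  \<open>I\<close>.\<close>

lemma ideal_homogeneous_core:
  assumes dg: "additive_deg dg" and I: "ideal I (free_alg n)"
  shows "ideal (homogeneous_core n dg I) (free_alg n)"
proof -
  interpret ideal I "free_alg n" by (rule I)
  let ?H = "homogeneous_core n dg I"
  show ?thesis
  proof (rule idealI[OF ring_free_alg])
    show "subgroup ?H (add_monoid (free_alg n))"
    proof (rule add.subgroupI)
      show "?H \<subseteq> carrier (free_alg n)" by (auto simp: homogeneous_core_def)
      have "proj dg d \<zero>\<^bsub>free_alg n\<^esub> = \<zero>\<^bsub>free_alg n\<^esub>" for d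
        by (auto simp: proj_def free_alg_simps(4))
      then have "\<zero>\<^bsub>free_alg n\<^esub> \<in> ?H"
        unfolding homogeneous_core_def by (simp add: ideal_zero[OF I])
      then show "?H \<noteq> {}" by blast
    next
      fix f assume f: "f \<in> ?H"
      then have c: "f \<in> carrier (free_alg n)" by (simp add: homogeneous_core_def)
      have "proj dg d (\<ominus>\<^bsub>free_alg n\<^esub> f) = \<ominus>\<^bsub>free_alg n\<^esub> proj dg d f" for d
        using c by (simp add: free_alg_a_inv proj_closed) (auto simp: proj_def)
      with f c show "\<ominus>\<^bsub>free_alg n\<^esub> f \<in> ?H"
        unfolding homogeneous_core_def by (simp add: ideal_neg[OF I])
    next
      fix f g assume "f \<in> ?H" "g \<in> ?H"
      then show "f \<oplus>\<^bsub>free_alg n\<^esub> g \<in> ?H"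
        unfolding homogeneous_core_def
        by (simp add: proj_add ideal_add[OF I])
    qed
  next
    fix f g assume f: "f \<in> ?H" and g: "g \<in> carrier (free_alg n)"
    then have c: "f \<in> carrier (free_alg n)" by (simp add: homogeneous_core_def)
    have "proj dg d (g \<otimes>\<^bsub>free_alg n\<^esub> f) \<in> I" for d
      unfolding proj_mult[OF dg g c] case_prod_unfold
      by (rule ideal_sum_mem[OF I finite_deg_pairs[OF g c, of dg d, unfolded case_prod_unfold]])
        (use f g in \<open>auto simp: homogeneous_core_def intro!: I_l_closed proj_closed\<close>)
    then show "g \<otimes>\<^bsub>free_alg n\<^esub> f \<in> ?H"
      using c g by (simp add: homogeneous_core_def free_alg_mult_closed)
    have "proj dg d (f \<otimes>\<^bsub>free_alg n\<^esub> g) \<in> I" for d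
      unfolding proj_mult[OF dg c g] case_prod_unfold
      by (rule ideal_sum_mem[OF I finite_deg_pairs[OF c g, of dg d, unfolded case_prod_unfold]])
        (use f g in \<open>auto simp: homogeneous_core_def intro!: I_r_closed proj_closed\<close>)
    then show "f \<otimes>\<^bsub>free_alg n\<^esub> g \<in> ?H"
      using c g by (simp add: homogeneous_core_def free_alg_mult_closed)
  qed
qed

text \<open>Each relation combines a two-letter word with its reversal, and an additive degree with
  values in a commutative monoid does not see the order of letters. So the generators are
  homogeneous for every such degree.\<close>

lemma super_ideal_homogeneous:
  assumes dg: "additive_deg dg" and f: "f \<in> super_ideal n"
  shows "proj dg d f \<in> super_ideal n"
proof -
  interpret I: ideal "super_ideal n" "free_alg n" by (rule ideal_super_ideal)
  have swap: "dg [a, b] = dg [b, a]" for a b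
  proof -
    have "dg ([a] @ [b]) = dg ([b] @ [a])"
      using dg by (simp only: additive_deg_def add.commute)
    then show ?thesis by simp
  qed
  have gen: "super_rels n \<subseteq> super_ideal n"
    unfolding super_ideal_def by (rule I.genideal_self[OF super_rels_subset])
  have hom: "proj dg d r \<in> {r, \<zero>\<^bsub>free_alg n\<^esub>}" if "r \<in> super_rels n" for r d
  proof -
    have word2: "word [a, b] \<in> carrier (free_alg n)" if "a \<in> vars n" "b \<in> vars n" for a b
      using that by (intro word_closed) simp
    from that consider
      i v where "i \<in> {1..n}" "v \<in> vars n"
        "r = word [X i, v] \<ominus>\<^bsub>free_alg n\<^esub> word [v, X i]"
      | a b where "a \<in> odd_vars n" "b \<in> odd_vars n"
        "r = word [a, b] \<oplus>\<^bsub>free_alg n\<^esub> word [b, a]"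
      unfolding super_rels_def by blast
    then show ?thesis
    proof cases
      case 1
      then have "X i \<in> vars n" by (simp add: vars_def)
      with 1 have r: "r = (\<lambda>w. word [X i, v] w - word [v, X i] w)"
        by (simp add: free_alg_minus word2)
      show ?thesis
        using swap[of "X i" v] unfolding r proj_diff proj_word[where n = n]
        by (auto simp: free_alg_simps(4))
    next
      case 2
      show ?thesis
        using swap[of a b] unfolding 2 proj_add proj_word[where n = n]
        by (auto simp: free_alg_simps(4,5))
    qed
  qed
  have "super_rels n \<subseteq> homogeneous_core n dg (super_ideal n)"
  proof
    fix r assume r: "r \<in> super_rels n"
    then have "proj dg d r \<in> super_ideal n" for d
      using hom[OF r, of d] gen ideal_zero[OF ideal_super_ideal] by auto
    with r show "r \<in> homogeneous_core n dg (super_ideal n)"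
      using super_rels_subset by (auto simp: homogeneous_core_def)
  qed
  then have "super_ideal n \<subseteq> homogeneous_core n dg (super_ideal n)"
    using I.genideal_minimal[OF ideal_homogeneous_core[OF dg ideal_super_ideal]]
    by (simp add: super_ideal_def)
  with f show ?thesis by (auto simp: homogeneous_core_def)
qed

section \<open>The projection onto the coinvariant ring\<close>

lemma super_class_hom: "ring_hom_ring (free_alg n) (super_alg n) (super_class n)"
proof -
  have "super_class n = (+>\<^bsub>free_alg n\<^esub>) (super_ideal n)"
    by (simp add: super_class_def fun_eq_iff)
  then show ?thesis
    unfolding super_alg_def by (metis ideal.rcos_ring_hom_ring ideal_super_ideal)
qed

lemma coinv_class_hom: "ring_hom_ring (super_alg n) (coinv n) (coinv_class n)"
proof -
  have "coinv_class n = (+>\<^bsub>super_alg n\<^esub>) (invariant_ideal n)"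
    by (simp add: coinv_class_def fun_eq_iff)
  then show ?thesis
    unfolding coinv_def by (metis ideal.rcos_ring_hom_ring ideal_invariant_ideal)
qed

lemma super_class_iff:
  assumes "f \<in> carrier (free_alg n)" "g \<in> carrier (free_alg n)"
  shows "super_class n f = super_class n g \<longleftrightarrow> (\<lambda>w. f w - g w) \<in> super_ideal n"
  unfolding super_class_def
  using ring.quotient_eq_iff_same_a_r_cos[OF ring_free_alg ideal_super_ideal assms]
  by (simp add: free_alg_minus[OF assms])

lemma mem_super_class: "g \<in> super_class n f \<longleftrightarrow> (\<lambda>w. g w - f w) \<in> super_ideal n"
proof -
  have "g = (\<lambda>w. h w + f w) \<longleftrightarrow> h = (\<lambda>w. g w - f w)" for h
    by (auto simp: fun_eq_iff algebra_simps)
  then show ?thesis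
    unfolding super_class_def a_r_coset_def' free_alg_simps(5) by auto
qed

text \<open>The composite of the two quotient maps. It lets all later work take place on
  representatives in the free algebra, where components are defined.\<close>

definition coinv_map :: "nat \<Rightarrow> (var list \<Rightarrow> complex) \<Rightarrow> (var list \<Rightarrow> complex) set set"
  where "coinv_map n f = coinv_class n (super_class n f)"

lemma coinv_map_hom: "ring_hom_ring (free_alg n) (coinv n) (coinv_map n)"
proof (rule ring_hom_ringI2[OF ring_free_alg ring_coinv])
  have "coinv_map n = coinv_class n \<circ> super_class n"
    by (simp add: coinv_map_def fun_eq_iff)
  then show "coinv_map n \<in> ring_hom (free_alg n) (coinv n)"
    using ring_hom_trans[OF ring_hom_ring.homh[OF super_class_hom] ring_hom_ring.homh[OF coinv_class_hom]]
    by simp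
qed

lemma super_class_surj: "super_class n ` carrier (free_alg n) = carrier (super_alg n)"
  unfolding super_alg_def FactRing_def A_RCOSETS_def' super_class_def by auto

lemma coinv_map_surj: "coinv_map n ` carrier (free_alg n) = carrier (coinv n)"
proof -
  have "coinv_class n ` carrier (super_alg n) = carrier (coinv n)"
    unfolding coinv_def FactRing_def A_RCOSETS_def' coinv_class_def by auto
  then show ?thesis
    unfolding super_class_surj[symmetric] by (simp add: image_image coinv_map_def)
qed

text \<open>The invariant ideal pulled back to the free algebra.\<close>

definition coinv_kernel :: "nat \<Rightarrow> (var list \<Rightarrow> complex) set"
  where "coinv_kernel n = a_kernel (free_alg n) (coinv n) (coinv_map n)"

lemma ideal_coinv_kernel: "ideal (coinv_kernel n) (free_alg n)"
  unfolding coinv_kernel_def by (rule ring_hom_ring.kernel_is_ideal[OF coinv_map_hom])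

lemma coinv_kernel_iff:
  assumes "f \<in> carrier (free_alg n)"
  shows "f \<in> coinv_kernel n \<longleftrightarrow> super_class n f \<in> invariant_ideal n"
proof -
  interpret ideal "invariant_ideal n" "super_alg n" by (rule ideal_invariant_ideal)
  have c: "super_class n f \<in> carrier (super_alg n)"
    using assms super_class_surj by auto
  have "f \<in> coinv_kernel n \<longleftrightarrow> coinv_class n (super_class n f) = invariant_ideal n"
    using assms by (simp add: coinv_kernel_def a_kernel_def' coinv_map_def coinv_def FactRing_def)
  also have "\<dots> \<longleftrightarrow> super_class n f \<in> invariant_ideal n"
    unfolding coinv_class_def
    using rcos_const_imp_mem[OF c] a_rcos_zero[OF ideal_invariant_ideal] by blast
  finally show ?thesis .
qed

lemma coinv_map_iff:
  assumes "f \<in> carrier (free_alg n)" "g \<in> carrier (free_alg n)"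
  shows "coinv_map n f = coinv_map n g \<longleftrightarrow> (\<lambda>w. f w - g w) \<in> coinv_kernel n"
proof -
  interpret h: ring_hom_ring "free_alg n" "coinv n" "coinv_map n" by (rule coinv_map_hom)
  have "(\<lambda>w. f w - g w) \<in> coinv_kernel n \<longleftrightarrow> coinv_map n (f \<ominus>\<^bsub>free_alg n\<^esub> g) = \<zero>\<^bsub>coinv n\<^esub>"
    unfolding free_alg_minus[OF assms, symmetric] coinv_kernel_def a_kernel_def' mem_Collect_eq
    using h.R.minus_closed[OF assms] by blast
  also have "coinv_map n (f \<ominus>\<^bsub>free_alg n\<^esub> g) = coinv_map n f \<ominus>\<^bsub>coinv n\<^esub> coinv_map n g"
    unfolding a_minus_def
    by (simp only: h.hom_add h.hom_a_inv h.R.a_inv_closed assms)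
  also have "\<dots> = \<zero>\<^bsub>coinv n\<^esub> \<longleftrightarrow> coinv_map n f = coinv_map n g"
    by (rule h.S.r_right_minus_eq) (rule h.hom_closed, rule assms)+
  finally show ?thesis ..
qed

section \<open>Homogeneity of the coinvariant ideal\<close>

definition tri_deg :: "var list \<Rightarrow> nat \<times> nat \<times> nat"
  where "tri_deg w = (x_deg w, theta_deg w, xi_deg w)"

lemma additive_tri_deg: "additive_deg tri_deg"
  by (simp add: additive_deg_def tri_deg_def x_deg_def theta_deg_def xi_deg_def)

lemma additive_mset: "additive_deg mset"
  by (simp add: additive_deg_def)

lemma tri_deg_perm: "tri_deg (map (perm_var \<sigma>) w) = tri_deg w"
proof -
  have "perm_var \<sigma> v \<in> range X \<longleftrightarrow> v \<in> range X" "perm_var \<sigma> v \<in> range Theta \<longleftrightarrow> v \<in> range Theta"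
    "perm_var \<sigma> v \<in> range Xi \<longleftrightarrow> v \<in> range Xi" for v
    by (cases v; auto simp: perm_var_def)+
  then show ?thesis
    by (simp add: tri_deg_def x_deg_def theta_deg_def xi_deg_def filter_map o_def)
qed

lemma perm_free_inverse:
  assumes "bij \<sigma>"
  shows "perm_free \<sigma> (perm_free (inv_into UNIV \<sigma>) f) = f" "perm_free (inv_into UNIV \<sigma>) (perm_free \<sigma> f) = f"
proof -
  have "perm_var \<sigma> (perm_var (inv_into UNIV \<sigma>) v) = v" "perm_var (inv_into UNIV \<sigma>) (perm_var \<sigma> v) = v" for v
    using assms by (cases v; simp add: perm_var_def bij_is_inj bij_is_surj surj_f_inv_f)+
  then show "perm_free \<sigma> (perm_free (inv_into UNIV \<sigma>) f) = f" "perm_free (inv_into UNIV \<sigma>) (perm_free \<sigma> f) = f"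
    using assms by (simp_all add: perm_free_def o_def inv_inv_eq)
qed

lemma proj_perm_free: "proj tri_deg d (perm_free \<sigma> f) = perm_free \<sigma> (proj tri_deg d f)"
  by (simp add: proj_def perm_free_def tri_deg_perm)

text \<open>Invariance of a single coset already makes the ideal stable, so the action on the relations
  need not be computed.\<close>

lemma perm_free_stable:
  assumes "perm_free \<sigma> ` super_class n f \<subseteq> super_class n f" "i \<in> super_ideal n"
  shows "perm_free \<sigma> i \<in> super_ideal n"
proof -
  \<comment> \<open>Two representatives of one class: their images under
    \<open>perm_free \<sigma>\<close> differ by \<open>perm_free \<sigma> i\<close>.\<close>
  have "(\<lambda>w. i w + f w) \<in> super_class n f" "f \<in> super_class n f"
    using assms(2) ideal_zero[OF ideal_super_ideal, of n]
    by (simp_all add: mem_super_class free_alg_simps(4))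
  then have "perm_free \<sigma> (\<lambda>w. i w + f w) \<in> super_class n f" "perm_free \<sigma> f \<in> super_class n f"
    using assms(1) by blast+
  then show ?thesis
    unfolding mem_super_class
    by (rule ideal_minus_mem[OF ideal_super_ideal, elim_format]) (simp add: perm_free_def)
qed

text \<open>Permuting indices preserves the tridegree, so the action commutes with taking
  components, and homogeneity of \<open>super_ideal\<close> carries this over to classes. The
  argument is special to \<open>tri_deg\<close>, as a permutation changes the full
  multidegree.\<close>

lemma positive_invariant_proj:
  assumes a: "super_class n f \<in> positive_invariants n" and f: "f \<in> carrier (free_alg n)"
  shows "super_class n (proj tri_deg d f) \<in> positive_invariants n"
proof -
  let ?p = "proj tri_deg d f"
  have inv: "perm_free \<sigma> ` super_class n f = super_class n f" if "\<sigma> permutes {1..n}" for \<sigma>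
    using a that by (simp add: positive_invariants_def perm_act_def)
  have ct: "g [] = 0" if "(\<lambda>w. g w - f w) \<in> super_ideal n" for g
    using a that by (simp add: positive_invariants_def mem_super_class)
  have f_self: "f \<in> super_class n f"
    using ideal_zero[OF ideal_super_ideal, of n] by (simp add: mem_super_class free_alg_simps(4))
  have sub: "perm_free \<sigma> ` super_class n ?p \<subseteq> super_class n ?p" if \<sigma>: "\<sigma> permutes {1..n}" for \<sigma>
  proof (rule image_subsetI)
    fix g assume "g \<in> super_class n ?p"
    then have "(\<lambda>w. g w - ?p w) \<in> super_ideal n" by (simp add: mem_super_class)
    then have 1: "perm_free \<sigma> (\<lambda>w. g w - ?p w) \<in> super_ideal n"
      using perm_free_stable inv[OF \<sigma>] by blast
    have "perm_free \<sigma> f \<in> super_class n f" using inv[OF \<sigma>] f_self by blast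
    then have "(\<lambda>w. perm_free \<sigma> f w - f w) \<in> super_ideal n" by (simp add: mem_super_class)
    \<comment> \<open>Invariance of the class of \<open>f\<close> is a membership in a homogeneous
      ideal, so it passes to the components of degree \<open>d\<close>.\<close>
    from super_ideal_homogeneous[OF additive_tri_deg this, of d]
    have 2: "(\<lambda>w. perm_free \<sigma> ?p w - ?p w) \<in> super_ideal n"
      by (simp add: proj_diff proj_perm_free)
    show "perm_free \<sigma> g \<in> super_class n ?p"
      using ideal_add[OF ideal_super_ideal 1 2]
      by (simp add: mem_super_class free_alg_simps(5) perm_free_def)
  qed
  have "perm_act \<sigma> (super_class n ?p) = super_class n ?p" if \<sigma>: "\<sigma> permutes {1..n}" for \<sigma>
  proof
    show "perm_act \<sigma> (super_class n ?p) \<subseteq> super_class n ?p"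
      unfolding perm_act_def by (rule sub[OF \<sigma>])
    \<comment> \<open>The reverse inclusion is the one already shown, applied to the inverse
      permutation.\<close>
    have "g = perm_free \<sigma> (perm_free (inv_into UNIV \<sigma>) g)" for g
      using perm_free_inverse(1)[OF permutes_bij[OF \<sigma>]] by simp
    then show "super_class n ?p \<subseteq> perm_act \<sigma> (super_class n ?p)"
      unfolding perm_act_def using sub[OF permutes_inv[OF \<sigma>]] by blast
  qed
  moreover have "g [] = 0" if "g \<in> super_class n ?p" for g
  proof -
    \<comment> \<open>Both \<open>g - ?p + f\<close> and \<open>f\<close> represent the class of
      \<open>f\<close>, so both have constant term zero. Hence \<open>g\<close> and
      \<open>?p\<close> agree at the empty word, where \<open>?p\<close> is either
      \<open>f []\<close> or zero.\<close>
    have "(\<lambda>w. g w - ?p w + f w) [] = 0" "f [] = 0"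
      using that ct[of "\<lambda>w. g w - ?p w + f w"] ct[of f] ideal_zero[OF ideal_super_ideal, of n]
      by (simp_all add: mem_super_class free_alg_simps(4))
    then show ?thesis by (simp add: proj_def split: if_splits)
  qed
  moreover have "super_class n ?p \<in> carrier (super_alg n)"
    unfolding super_class_surj[symmetric] by (intro imageI proj_closed f)
  ultimately show ?thesis unfolding positive_invariants_def by blast
qed

lemma super_ideal_subset_coinv_kernel: "super_ideal n \<subseteq> coinv_kernel n"
proof
  fix i assume i: "i \<in> super_ideal n"
  interpret h: ring_hom_ring "free_alg n" "super_alg n" "super_class n" by (rule super_class_hom)
  have c: "i \<in> carrier (free_alg n)" by (rule ideal_carrier[OF ideal_super_ideal i])
  have "super_class n i = super_class n \<zero>\<^bsub>free_alg n\<^esub>"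
    using i by (subst super_class_iff[OF c h.R.zero_closed]) (simp add: free_alg_simps(4))
  then have "super_class n i \<in> invariant_ideal n"
    using ideal_zero[OF ideal_invariant_ideal] h.hom_zero by simp
  then show "i \<in> coinv_kernel n" by (simp only: coinv_kernel_iff[OF c])
qed

text \<open>The image of the homogeneous core in the superspace ring is an ideal containing all
  generators of the invariant ideal, hence the invariant ideal itself. So an element of the kernel
  agrees with an element of the core up to \<open>super_ideal\<close>, which is homogeneous and lies
  in the kernel.\<close>

lemma coinv_kernel_homogeneous:
  assumes f: "f \<in> coinv_kernel n"
  shows "proj tri_deg d f \<in> coinv_kernel n"
proof -
  interpret S: ring "super_alg n" by (rule ring_super_alg)
  let ?H = "homogeneous_core n tri_deg (coinv_kernel n)"
  have gen: "positive_invariants n \<subseteq> invariant_ideal n"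
    unfolding invariant_ideal_def by (rule S.genideal_self) (auto simp: positive_invariants_def)
  have "super_class n = (+>\<^bsub>free_alg n\<^esub>) (super_ideal n)"
    by (simp add: super_class_def fun_eq_iff)
  then have ideal: "ideal (super_class n ` ?H) (super_alg n)"
    using ring.ring_ideal_imp_quot_ideal[OF ring_free_alg ideal_super_ideal
      ideal_homogeneous_core[OF additive_tri_deg ideal_coinv_kernel]]
    by (simp only: super_alg_def)
  have "positive_invariants n \<subseteq> super_class n ` ?H"
  proof
    fix a assume a: "a \<in> positive_invariants n"
    then have "a \<in> carrier (super_alg n)" by (simp add: positive_invariants_def)
    then obtain g where g: "g \<in> carrier (free_alg n)" "a = super_class n g"
      unfolding super_class_surj[symmetric] by blast
    \<comment> \<open>Each component of an invariant representative is again a generator modulo the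
      relations.\<close>
    have "proj tri_deg d g \<in> coinv_kernel n" for d
      using positive_invariant_proj[OF a[unfolded g(2)] g(1), of d] gen
      unfolding coinv_kernel_iff[OF proj_closed[OF g(1)]] by blast
    then show "a \<in> super_class n ` ?H"
      unfolding g(2) homogeneous_core_def using g(1) by blast
  qed
  from S.genideal_minimal[OF ideal this] have "invariant_ideal n \<subseteq> super_class n ` ?H"
    by (simp only: invariant_ideal_def)
  moreover have c: "f \<in> carrier (free_alg n)" by (rule ideal_carrier[OF ideal_coinv_kernel f])
  ultimately obtain h where h: "h \<in> ?H" "super_class n f = super_class n h"
    using f coinv_kernel_iff[OF c] by blast
  then have "h \<in> carrier (free_alg n)" and 1: "proj tri_deg d h \<in> coinv_kernel n"
    unfolding homogeneous_core_def by blast+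
  then have "(\<lambda>w. f w - h w) \<in> super_ideal n"
    using h(2) super_class_iff[OF c] by blast
  from super_ideal_homogeneous[OF additive_tri_deg this, of d]
  have "(\<lambda>w. proj tri_deg d f w - proj tri_deg d h w) \<in> coinv_kernel n"
    using super_ideal_subset_coinv_kernel by (auto simp: proj_diff)
  from ideal_add[OF ideal_coinv_kernel this 1] show ?thesis
    by (simp add: free_alg_simps(5))
qed

section \<open>Graded components of the coinvariant ring\<close>

lemma const_closed: "const c \<in> carrier (free_alg n)"
proof -
  have "{w. const c w \<noteq> 0} \<subseteq> {[]}" by (auto simp: const_def)
  then have "finite {w. const c w \<noteq> 0}" "{w. const c w \<noteq> 0} \<subseteq> lists (vars n)"
    by (auto intro: finite_subset)
  then show ?thesis by (simp only: free_alg_simps(1) mem_Collect_eq)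
qed

lemma const_mult: "const c \<otimes>\<^bsub>free_alg n\<^esub> f = (\<lambda>w. c * f w)"
proof
  fix w
  have "(const c \<otimes>\<^bsub>free_alg n\<^esub> f) w = (\<Sum>k\<le>length w. if k = 0 then c * f w else 0)"
    unfolding free_alg_simps by (intro sum.cong refl) (auto simp: const_def)
  then show "(const c \<otimes>\<^bsub>free_alg n\<^esub> f) w = c * f w" by simp
qed

lemma subfield_range_const: "subfield (range const) (free_alg n)"
proof -
  interpret ring "free_alg n" by (rule ring_free_alg)
  have mult: "const a \<otimes>\<^bsub>free_alg n\<^esub> const b = const (a * b)" for a b
    unfolding const_mult by (auto simp: const_def)
  have one: "\<one>\<^bsub>free_alg n\<^esub> = const 1" and zero: "\<zero>\<^bsub>free_alg n\<^esub> = const 0"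
    by (auto simp: free_alg_simps const_def)
  have inj: "const a = const b \<longleftrightarrow> a = b" for a b
    by (metis const_def)
  show ?thesis
  proof (rule subfieldI)
    show "subcring (range const) (free_alg n)"
    proof (rule subcringI[OF subringI])
      show "range const \<subseteq> carrier (free_alg n)" using const_closed by blast
      show "\<one>\<^bsub>free_alg n\<^esub> \<in> range const" by (simp add: one)
    next
      fix h assume "h \<in> range const"
      then obtain c where h: "h = const c" by blast
      have "\<ominus>\<^bsub>free_alg n\<^esub> h = const (- c)"
        unfolding h free_alg_a_inv[OF const_closed] by (auto simp: const_def)
      then show "\<ominus>\<^bsub>free_alg n\<^esub> h \<in> range const" by simp
    next
      fix h1 h2 assume "h1 \<in> range const" "h2 \<in> range const"
      then obtain a b where h: "h1 = const a" "h2 = const b" by blast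
      show "h1 \<otimes>\<^bsub>free_alg n\<^esub> h2 \<in> range const" "h1 \<otimes>\<^bsub>free_alg n\<^esub> h2 = h2 \<otimes>\<^bsub>free_alg n\<^esub> h1"
        unfolding h mult by (simp_all add: mult.commute)
      have "h1 \<oplus>\<^bsub>free_alg n\<^esub> h2 = const (a + b)"
        unfolding h by (auto simp: free_alg_simps(5) const_def)
      then show "h1 \<oplus>\<^bsub>free_alg n\<^esub> h2 \<in> range const" by simp
    qed
    have "const a \<in> Units (free_alg n\<lparr>carrier := range const\<rparr>) \<longleftrightarrow> a \<noteq> 0" for a
    proof -
      have "(\<exists>b. const (b * a) = const 1 \<and> const (a * b) = const 1) \<longleftrightarrow> a \<noteq> 0"
        unfolding inj by (metis left_inverse mult.commute mult_zero_left zero_neq_one)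
      then show ?thesis by (simp add: Units_def mult one)
    qed
    moreover have "Units (free_alg n\<lparr>carrier := range const\<rparr>) \<subseteq> range const"
      by (auto simp: Units_def)
    ultimately show "Units (free_alg n\<lparr>carrier := range const\<rparr>) = range const - {\<zero>\<^bsub>free_alg n\<^esub>}"
      unfolding zero using inj by blast
  qed
qed

lemma coinv_scalars_eq: "coinv_scalars n = coinv_map n ` range const"
  by (auto simp: coinv_scalars_def coinv_map_def)

text \<open>The constants form a subfield of the free algebra, and a ring homomorphism into a
  nonzero ring maps a subfield to a subfield.\<close>

lemma subfield_coinv_scalars:
  assumes "\<one>\<^bsub>coinv n\<^esub> \<noteq> \<zero>\<^bsub>coinv n\<^esub>"
  shows "subfield (coinv_scalars n) (coinv n)"
  unfolding coinv_scalars_eq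
  by (rule ring_hom_ring.img_is_subfield(2)[OF coinv_map_hom subfield_range_const assms])

section \<open>Independent lists over a subfield\<close>

context ring
begin

text \<open>Zero lies in every span, so it cannot be the head of an independent list. Applied to the
  basis, it shows that no basis monomial vanishes in the quotient.\<close>

lemma independent_nonzero:
  assumes "subfield K R" "independent K Us"
  shows "\<zero> \<notin> set Us"
  using assms(2)
proof (induction Us rule: list.induct)
  case (Cons u Us)
  then have "u \<notin> Span K Us" "independent K Us" by (auto dest: independent_backwards)
  moreover have "\<zero> \<in> Span K Us"
    using Span_subgroup_props(2)[OF assms(1)] independent_in_carrier[OF \<open>independent K Us\<close>] by blast
  ultimately show ?case using Cons.IH by (auto simp del: Span.simps)
qed simp

text \<open>The predicate acts on the labels before \<open>f\<close> is applied, because a degree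
  belongs to a word and not to its image in the quotient.\<close>

lemma independent_map_filter:
  assumes "subfield K R" "independent K (map f us)"
  shows "independent K (map f (filter P us))"
  using assms(2)
proof (induction us rule: list.induct)
  case (Cons u us)
  then have u: "f u \<in> carrier R" "f u \<notin> Span K (map f us)" and us: "independent K (map f us)"
    by (auto dest: independent_backwards)
  have "Span K (map f (filter P us)) \<subseteq> Span K (map f us)"
    by (rule mono_Span_sublist[OF assms(1) _ independent_in_carrier[OF us]]) auto
  with u Cons.IH[OF us] show ?case by (auto intro: li_Cons simp del: Span.simps)
qed simp

end

section \<open>Graded components as spans of words\<close>

lemma coinv_component_iff:
  "x \<in> coinv_component n a b c \<longleftrightarrow>
    (\<exists>f\<in>carrier (free_alg n). x = coinv_map n f \<and> proj tri_deg (a, b, c) f = f)"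
proof -
  have "(\<forall>w. f w \<noteq> 0 \<longrightarrow> x_deg w = a \<and> theta_deg w = b \<and> xi_deg w = c) \<longleftrightarrow>
    proj tri_deg (a, b, c) f = f" for f
    by (auto simp: proj_def tri_deg_def fun_eq_iff)
  then show ?thesis
    unfolding coinv_component_def free_component_def coinv_map_def by auto
qed

lemma Span_subset_coinv_component:
  assumes "\<forall>w\<in>set ws. w \<in> lists (vars n) \<and> tri_deg w = (a, b, c)"
  shows "ring.Span (coinv n) (coinv_scalars n) (map (\<lambda>w. coinv_map n (word w)) ws)
    \<subseteq> coinv_component n a b c"
  using assms
proof (induction ws)
  interpret h: ring_hom_ring "free_alg n" "coinv n" "coinv_map n" by (rule coinv_map_hom)
  {
    case Nil
    have "proj tri_deg (a, b, c) \<zero>\<^bsub>free_alg n\<^esub> = \<zero>\<^bsub>free_alg n\<^esub>"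
      by (auto simp: proj_def free_alg_simps(4))
    then show ?case
      by (auto simp: coinv_component_iff intro!: bexI[of _ "\<zero>\<^bsub>free_alg n\<^esub>"])
  next
    case (Cons w ws)
    show ?case
    proof
      fix x assume "x \<in> h.S.Span (coinv_scalars n) (map (\<lambda>w. coinv_map n (word w)) (w # ws))"
      then obtain k v where k: "k \<in> coinv_scalars n"
        and v: "v \<in> h.S.Span (coinv_scalars n) (map (\<lambda>w. coinv_map n (word w)) ws)"
        and x: "x = k \<otimes>\<^bsub>coinv n\<^esub> coinv_map n (word w) \<oplus>\<^bsub>coinv n\<^esub> v"
        by (auto simp: h.S.line_extension_mem_iff)
      obtain r where r: "k = coinv_map n (const r)" using k by (auto simp: coinv_scalars_eq)
      have "\<forall>w\<in>set ws. w \<in> lists (vars n) \<and> tri_deg w = (a, b, c)"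
        using Cons.prems by simp
      from subsetD[OF Cons.IH[OF this] v]
      obtain f where f: "f \<in> carrier (free_alg n)" "v = coinv_map n f" "proj tri_deg (a, b, c) f = f"
        unfolding coinv_component_iff by blast
      have w: "word w \<in> carrier (free_alg n)" "tri_deg w = (a, b, c)"
        using Cons.prems word_closed by auto
      let ?g = "const r \<otimes>\<^bsub>free_alg n\<^esub> word w \<oplus>\<^bsub>free_alg n\<^esub> f"
      have "x = coinv_map n ?g"
        unfolding x r f(2) by (simp only: h.hom_add h.hom_mult h.R.m_closed const_closed w(1) f(1))
      moreover have "proj tri_deg (a, b, c) ?g = ?g"
        unfolding proj_add f(3) by (auto simp: const_mult proj_def word_def w(2) free_alg_simps(5) fun_eq_iff)
      moreover have "?g \<in> carrier (free_alg n)"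
        by (intro h.R.a_closed h.R.m_closed const_closed w(1) f(1))
      ultimately show "x \<in> coinv_component n a b c"
        unfolding coinv_component_iff by blast
    qed
  }
qed

text \<open>Components are defined for representatives only. The representative \<open>g\<close> is
  the same linear combination formed with the words themselves, and its component of degree
  \<open>d\<close> retains exactly the terms whose words have degree \<open>d\<close>.\<close>

lemma Span_proj:
  assumes "set ws \<subseteq> lists (vars n)"
    and "x \<in> ring.Span (coinv n) (coinv_scalars n) (map (\<lambda>w. coinv_map n (word w)) ws)"
  shows "\<exists>g\<in>carrier (free_alg n). coinv_map n g = x \<and>
    coinv_map n (proj tri_deg d g) \<in>
      ring.Span (coinv n) (coinv_scalars n)
        (map (\<lambda>w. coinv_map n (word w)) (filter (\<lambda>w. tri_deg w = d) ws))"
  using assms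
proof (induction ws arbitrary: x)
  interpret h: ring_hom_ring "free_alg n" "coinv n" "coinv_map n" by (rule coinv_map_hom)
  {
    case Nil
    have "proj tri_deg d \<zero>\<^bsub>free_alg n\<^esub> = \<zero>\<^bsub>free_alg n\<^esub>"
      by (auto simp: proj_def free_alg_simps(4))
    with Nil show ?case
      by (auto intro!: bexI[of _ "\<zero>\<^bsub>free_alg n\<^esub>"])
  next
    case (Cons w ws)
    let ?S = "\<lambda>ws. h.S.Span (coinv_scalars n) (map (\<lambda>w. coinv_map n (word w)) ws)"
    let ?P = "\<lambda>w. tri_deg w = d"
    from Cons.prems(2) obtain k v where k: "k \<in> coinv_scalars n" and v: "v \<in> ?S ws"
      and x: "x = k \<otimes>\<^bsub>coinv n\<^esub> coinv_map n (word w) \<oplus>\<^bsub>coinv n\<^esub> v"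
      by (auto simp: h.S.line_extension_mem_iff)
    obtain r where r: "k = coinv_map n (const r)" using k by (auto simp: coinv_scalars_eq)
    obtain g where g: "g \<in> carrier (free_alg n)" "v = coinv_map n g"
      "coinv_map n (proj tri_deg d g) \<in> ?S (filter ?P ws)"
      using Cons v by force
    have w: "word w \<in> carrier (free_alg n)"
      using Cons.prems(1) word_closed by auto
    let ?m = "const r \<otimes>\<^bsub>free_alg n\<^esub> word w"
    have m: "?m \<in> carrier (free_alg n)" by (intro h.R.m_closed const_closed w)
    have hm: "coinv_map n ?m = k \<otimes>\<^bsub>coinv n\<^esub> coinv_map n (word w)"
      unfolding r by (simp only: h.hom_mult const_closed w)
    have pg: "proj tri_deg d g \<in> carrier (free_alg n)" by (rule proj_closed[OF g(1)])
    have "coinv_map n (proj tri_deg d (?m \<oplus>\<^bsub>free_alg n\<^esub> g)) \<in> ?S (filter ?P (w # ws))"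
    \<comment> \<open>The new term is a multiple of one word, so its component of degree
      \<open>d\<close> is either all of it or zero.\<close>
    proof (cases "?P w")
      case True
      then have "proj tri_deg d (?m \<oplus>\<^bsub>free_alg n\<^esub> g) = ?m \<oplus>\<^bsub>free_alg n\<^esub> proj tri_deg d g"
        unfolding proj_add by (auto simp: const_mult proj_def word_def free_alg_simps(5) fun_eq_iff)
      then have "coinv_map n (proj tri_deg d (?m \<oplus>\<^bsub>free_alg n\<^esub> g)) =
        k \<otimes>\<^bsub>coinv n\<^esub> coinv_map n (word w) \<oplus>\<^bsub>coinv n\<^esub> coinv_map n (proj tri_deg d g)"
        by (simp only: h.hom_add m pg hm)
      with True k g(3) show ?thesis by (auto simp: h.S.line_extension_mem_iff)
    next
      case False
      then have "proj tri_deg d (?m \<oplus>\<^bsub>free_alg n\<^esub> g) = proj tri_deg d g"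
        unfolding proj_add by (auto simp: free_alg_simps(5) const_mult proj_def word_def)
      with False g(3) show ?thesis by simp
    qed
    moreover have "coinv_map n (?m \<oplus>\<^bsub>free_alg n\<^esub> g) = x"
      unfolding x g(2) by (simp only: h.hom_add m g(1) hm)
    moreover have "?m \<oplus>\<^bsub>free_alg n\<^esub> g \<in> carrier (free_alg n)" by (intro h.R.a_closed m g(1))
    ultimately show ?case by blast
  }
qed

text \<open>An element of the component has a homogeneous representative \<open>f\<close> and, from
  the spanning words, a representative \<open>g\<close> with controlled component. Their difference
  lies in the homogeneous ideal \<open>coinv_kernel\<close>, so \<open>f\<close> may be replaced by
  the component of \<open>g\<close>.\<close>

lemma coinv_component_eq_Span:
  assumes ws: "set ws \<subseteq> lists (vars n)"
    and span: "ring.Span (coinv n) (coinv_scalars n) (map (\<lambda>w. coinv_map n (word w)) ws)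
      = carrier (coinv n)"
  shows "coinv_component n a b c = ring.Span (coinv n) (coinv_scalars n)
    (map (\<lambda>w. coinv_map n (word w)) (filter (\<lambda>w. tri_deg w = (a, b, c)) ws))"
    (is "_ = ?S")
proof
  show "?S \<subseteq> coinv_component n a b c"
    using ws by (intro Span_subset_coinv_component) auto
  show "coinv_component n a b c \<subseteq> ?S"
  proof
    fix x assume "x \<in> coinv_component n a b c"
    then obtain f where f: "f \<in> carrier (free_alg n)" "x = coinv_map n f"
      "proj tri_deg (a, b, c) f = f"
      by (auto simp: coinv_component_iff)
    have "x \<in> carrier (coinv n)" unfolding f(2) coinv_map_surj[symmetric] using f(1) by (rule imageI)
    then obtain g where g: "g \<in> carrier (free_alg n)" "coinv_map n g = x"
      "coinv_map n (proj tri_deg (a, b, c) g) \<in> ?S"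
      using Span_proj[OF ws, of x "(a, b, c)"] span by blast
    have "(\<lambda>w. f w - g w) \<in> coinv_kernel n"
      using g(2) coinv_map_iff[OF f(1) g(1)] f(2) by simp
    from coinv_kernel_homogeneous[OF this, of "(a, b, c)"]
    have "(\<lambda>w. f w - proj tri_deg (a, b, c) g w) \<in> coinv_kernel n"
      by (simp add: proj_diff f(3))
    then have "x = coinv_map n (proj tri_deg (a, b, c) g)"
      unfolding f(2) coinv_map_iff[OF f(1) proj_closed[OF g(1)]] .
    with g(3) show "x \<in> ?S" by simp
  qed
qed

lemma dim_coinv_component:
  assumes one: "\<one>\<^bsub>coinv n\<^esub> \<noteq> \<zero>\<^bsub>coinv n\<^esub>"
    and ws: "set ws \<subseteq> lists (vars n)"
    and indep: "ring.independent (coinv n) (coinv_scalars n) (map (\<lambda>w. coinv_map n (word w)) ws)"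
    and span: "ring.Span (coinv n) (coinv_scalars n) (map (\<lambda>w. coinv_map n (word w)) ws)
      = carrier (coinv n)"
  shows "ring.dim (coinv n) (coinv_scalars n) (coinv_component n a b c) =
    length (filter (\<lambda>w. tri_deg w = (a, b, c)) ws)"
proof -
  interpret ring "coinv n" by (rule ring_coinv)
  note K = subfield_coinv_scalars[OF one]
  show ?thesis
    using dimI[OF K dimensionI[OF K independent_map_filter[OF K indep]
      coinv_component_eq_Span[OF ws span, symmetric]], of a b c]
    by (simp add: over_def)
qed

section \<open>Paths, exponents and monomials\<close>

text \<open>Functions are extensional on \<open>{1..n}\<close>, so that each exponent vector is
  counted once. The strict bound is the stair value plus one, and the range is empty for a negative
  stair value, just as the matching \<open>q_int\<close> is then zero.\<close>

definition exponents :: "nat \<Rightarrow> step list \<Rightarrow> (nat \<Rightarrow> nat) set"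
  where "exponents n \<pi> = (\<Pi>\<^sub>E i\<in>{1..n}. {..<nat (stair_exp (T_set \<pi>) (S_set \<pi>) i + 1)})"

definition mon_word :: "nat \<Rightarrow> step list \<times> (nat \<Rightarrow> nat) \<Rightarrow> var list"
  where "mon_word n p =
    concat (map (\<lambda>i. replicate (snd p i) (X i)) [1..<Suc n]) @
    map Theta (sorted_list_of_set (T_set (fst p))) @ map Xi (sorted_list_of_set (S_set (fst p)))"

text \<open>Monomials are indexed by pairs of a path and an exponent vector. That distinct pairs
  give distinct elements of the superspace ring is derived later from linear independence.\<close>

definition mon_index :: "nat \<Rightarrow> (step list \<times> (nat \<Rightarrow> nat)) set"
  where "mon_index n = Sigma (motzkin_paths n) (exponents n)"

lemma finite_T_set [simp]: "finite (T_set \<pi>)" and finite_S_set [simp]: "finite (S_set \<pi>)"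
  by (simp_all add: T_set_def S_set_def)

lemma finite_exponents: "finite (exponents n \<pi>)"
  by (simp add: exponents_def finite_PiE)

lemma finite_mon_index: "finite (mon_index n)"
  by (simp add: mon_index_def finite_motzkin_paths finite_exponents)

lemma set_mon_word:
  assumes "p \<in> mon_index n"
  shows "mon_word n p \<in> lists (vars n)"
proof -
  have "length (fst p) = n" using assms by (auto simp: mon_index_def motzkin_paths_def)
  then have "T_set (fst p) \<subseteq> {1..n}" "S_set (fst p) \<subseteq> {1..n}"
    by (auto simp: T_set_def S_set_def)
  then have "Theta ` T_set (fst p) \<subseteq> vars n" "Xi ` S_set (fst p) \<subseteq> vars n"
    unfolding vars_def by blast+
  moreover have "set (concat (map (\<lambda>i. replicate (snd p i) (X i)) [1..<Suc n])) \<subseteq> vars n"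
    by (auto simp: vars_def)
  ultimately have "set (mon_word n p) \<subseteq> vars n"
    by (simp add: mon_word_def)
  then show ?thesis by (auto simp: in_lists_conv_set)
qed

lemma B_set_eq: "B_set n = (\<lambda>p. super_class n (word (mon_word n p))) ` mon_index n"
proof (intro equalityI subsetI)
  fix b assume "b \<in> B_set n"
  then obtain \<pi> \<alpha> where \<pi>: "\<pi> \<in> motzkin_paths n" and b: "b = super_monomial n \<alpha> (T_set \<pi>) (S_set \<pi>)"
    and \<alpha>: "\<forall>i\<in>{1..n}. int (\<alpha> i) \<le> stair_exp (T_set \<pi>) (S_set \<pi>) i"
    by (auto simp: B_set_def)
  \<comment> \<open>Only the values of \<open>\<alpha>\<close> on \<open>{1..n}\<close> enter the
    monomial, so cutting off the others leaves the word unchanged and makes the vector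
    extensional.\<close>
  let ?p = "(\<pi>, restrict \<alpha> {1..n})"
  have "map (\<lambda>i. replicate (\<alpha> i) (X i)) [1..<Suc n] =
    map (\<lambda>i. replicate (restrict \<alpha> {1..n} i) (X i)) [1..<Suc n]"
    by (intro map_cong refl) (simp del: upt_Suc)
  then have "b = super_class n (word (mon_word n ?p))"
    by (simp only: b super_monomial_def mon_word_def fst_conv snd_conv)
  moreover have "?p \<in> mon_index n"
    using \<pi> \<alpha> by (auto simp: mon_index_def exponents_def zless_nat_eq_int_zless)
  ultimately show "b \<in> (\<lambda>p. super_class n (word (mon_word n p))) ` mon_index n" by blast
next
  fix b assume "b \<in> (\<lambda>p. super_class n (word (mon_word n p))) ` mon_index n"
  then obtain \<pi> \<alpha> where \<pi>: "\<pi> \<in> motzkin_paths n" and \<alpha>: "\<alpha> \<in> exponents n \<pi>"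
    and b: "b = super_class n (word (mon_word n (\<pi>, \<alpha>)))"
    by (auto simp: mon_index_def)
  have "int (\<alpha> i) \<le> stair_exp (T_set \<pi>) (S_set \<pi>) i" if "i \<in> {1..n}" for i
  proof -
    have "\<alpha> i \<in> {..<nat (stair_exp (T_set \<pi>) (S_set \<pi>) i + 1)}"
      using PiE_mem[OF \<alpha>[unfolded exponents_def] that] .
    then show ?thesis by (simp add: zless_nat_eq_int_zless)
  qed
  moreover have "b = super_monomial n \<alpha> (T_set \<pi>) (S_set \<pi>)"
    by (simp add: b super_monomial_def mon_word_def)
  ultimately show "b \<in> B_set n"
    using \<pi> unfolding B_set_def by blast
qed

lemma tri_deg_mon_word:
  "tri_deg (mon_word n p) = ((\<Sum>i=1..n. snd p i), deg_theta (fst p), deg_xi (fst p))"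
proof -
  have x: "filter (\<lambda>v. v \<in> range X) (concat (map (\<lambda>i. replicate (\<alpha> i) (X i)) is)) =
      concat (map (\<lambda>i. replicate (\<alpha> i) (X i)) is)"
    "filter (\<lambda>v. v \<in> range Theta) (concat (map (\<lambda>i. replicate (\<alpha> i) (X i)) is)) = []"
    "filter (\<lambda>v. v \<in> range Xi) (concat (map (\<lambda>i. replicate (\<alpha> i) (X i)) is)) = []"
    for \<alpha> and "is" :: "nat list"
    by (auto simp: filter_id_conv filter_empty_conv)
  have "length (concat (map (\<lambda>i. replicate (\<alpha> i) (X i)) [1..<Suc n])) = (\<Sum>i=1..n. \<alpha> i)" for \<alpha>
    by (simp add: length_concat o_def interv_sum_list_conv_sum_set_nat atLeastLessThanSuc_atLeastAtMost
        del: upt_Suc)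
  moreover have "filter (\<lambda>v. v \<in> range X) (map Theta js) = []" "filter (\<lambda>v. v \<in> range X) (map Xi js) = []"
    "filter (\<lambda>v. v \<in> range Theta) (map Theta js) = map Theta js" "filter (\<lambda>v. v \<in> range Theta) (map Xi js) = []"
    "filter (\<lambda>v. v \<in> range Xi) (map Theta js) = []" "filter (\<lambda>v. v \<in> range Xi) (map Xi js) = map Xi js" for js
    by (auto simp: filter_id_conv filter_empty_conv)
  ultimately show ?thesis
    unfolding tri_deg_def x_deg_def theta_deg_def xi_deg_def mon_word_def filter_append x
    by (simp add: deg_theta_def deg_xi_def del: upt_Suc)
qed

lemma count_mon_word:
  "count (mset (mon_word n p)) (X i) = (if i \<in> {1..n} then snd p i else 0)"
  "count (mset (mon_word n p)) (Theta i) = of_bool (i \<in> T_set (fst p))"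
  "count (mset (mon_word n p)) (Xi i) = of_bool (i \<in> S_set (fst p))"
proof -
  have cl: "count (mset (map f js)) (f i) = of_bool (i \<in> set js)"
    if "distinct js" "inj f" for f :: "nat \<Rightarrow> var" and js
    using that by (induction js) (auto simp: inj_eq)
  have cl0: "count (mset (map f js)) v = 0" if "v \<notin> range f" for f :: "nat \<Rightarrow> var" and js v
    using that by (auto simp: count_eq_zero_iff)
  have cx: "count (mset (concat (map (\<lambda>i. replicate (\<alpha> i) (X i)) js))) (X i) =
    (if i \<in> set js then \<alpha> i else 0)" if "distinct js" for \<alpha> js
    using that by (induction js) auto
  have cx0: "count (mset (concat (map (\<lambda>i. replicate (\<alpha> i) (X i)) js))) v = 0"
    if "v \<notin> range X" for \<alpha> js v
    using that by (induction js) auto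
  have inj: "inj X" "inj Theta" "inj Xi" by (auto intro: injI)
  show "count (mset (mon_word n p)) (X i) = (if i \<in> {1..n} then snd p i else 0)"
    unfolding mon_word_def mset_append count_union by (subst cx, simp, subst (1 2) cl0) auto
  show "count (mset (mon_word n p)) (Theta i) = of_bool (i \<in> T_set (fst p))"
    unfolding mon_word_def mset_append count_union
    by (subst cx0, blast, subst cl[OF _ inj(2)], simp, subst cl0) auto
  show "count (mset (mon_word n p)) (Xi i) = of_bool (i \<in> S_set (fst p))"
    unfolding mon_word_def mset_append count_union
    by (subst cx0, blast, subst cl0, blast, subst cl[OF _ inj(3)]) auto
qed

text \<open>The four kinds of step carry the four possible combinations of decorations, so
  membership of an index in the two sets determines the step there.\<close>

lemma path_eqI:
  assumes "length \<pi> = length \<rho>" "T_set \<pi> = T_set \<rho>" "S_set \<pi> = S_set \<rho>"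
  shows "\<pi> = \<rho>"
proof (rule nth_equalityI[OF assms(1)])
  fix i assume i: "i < length \<pi>"
  \<comment> \<open>Lists are indexed from 0 and steps from 1, so entry \<open>i\<close> is step
    \<open>Suc i\<close>.\<close>
  have "Suc i \<in> T_set \<pi> \<longleftrightarrow> Suc i \<in> T_set \<rho>" "Suc i \<in> S_set \<pi> \<longleftrightarrow> Suc i \<in> S_set \<rho>"
    using assms by simp_all
  then show "\<pi> ! i = \<rho> ! i"
    using i assms(1) by (cases "\<pi> ! i"; cases "\<rho> ! i") (auto simp: T_set_def S_set_def)
qed

text \<open>Letter multiplicities recover the exponents and both index sets, and the index sets
  recover the path.\<close>

lemma inj_on_mset_mon_word: "inj_on (\<lambda>p. mset (mon_word n p)) (mon_index n)"
proof (rule inj_onI)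
  fix p q assume p: "p \<in> mon_index n" and q: "q \<in> mon_index n"
    and eq: "mset (mon_word n p) = mset (mon_word n q)"
  have "of_bool (i \<in> T_set (fst p)) = (of_bool (i \<in> T_set (fst q)) :: nat)"
    "of_bool (i \<in> S_set (fst p)) = (of_bool (i \<in> S_set (fst q)) :: nat)" for i
    by (simp_all only: count_mon_word(2,3)[of n, symmetric] eq)
  then have "T_set (fst p) = T_set (fst q)" "S_set (fst p) = S_set (fst q)"
    by (auto simp only: of_bool_eq_iff set_eq_iff)
  then have fst: "fst p = fst q"
    using p q by (intro path_eqI) (auto simp: mon_index_def motzkin_paths_def)
  have mem: "snd p \<in> exponents n (fst p)" "snd q \<in> exponents n (fst p)"
    using p q fst by (auto simp: mon_index_def)
  have "snd p i = snd q i" if "i \<in> {1..n}" for i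
    using that count_mon_word(1)[of n p i] count_mon_word(1)[of n q i] by (simp add: eq)
  then have "snd p = snd q" by (rule PiE_ext[OF mem[unfolded exponents_def]])
  with fst show "p = q" by (rule prod_eqI)
qed

section \<open>Coefficients of the path sum\<close>

lemma qvar_power_nth:
  "fps_nth (fps_nth (fps_nth (uvar ^ i * vvar ^ j * qvar ^ k) c) b) a =
    of_bool (k = a \<and> i = b \<and> j = c)"
proof -
  \<comment> \<open>The nested series is read from the outside in: a power of the outermost variable
    \<open>vvar\<close> times a constant in it, and inside that constant likewise for
    \<open>uvar\<close>, whose coefficients are series in \<open>q\<close>.\<close>
  have "uvar ^ i * vvar ^ j * qvar ^ k =
    fps_const (fps_X ^ i * fps_const (fps_X ^ k)) * fps_X ^ j"
    by (simp add: uvar_def vvar_def qvar_def fps_const_power mult.commute mult.left_commute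
        flip: fps_const_mult)
  then show ?thesis by (auto simp: fps_X_power_nth)
qed

text \<open>Expanding the product means choosing one power from each \<open>q_int\<close>, that is,
  one exponent vector in \<open>exponents n \<pi>\<close>.\<close>

lemma stair_q_eq:
  assumes "length \<pi> = n"
  shows "stair_q \<pi> = (\<Sum>\<alpha>\<in>exponents n \<pi>. qvar ^ (\<Sum>i=1..n. \<alpha> i))"
  unfolding stair_q_def q_int_def assms exponents_def
  by (subst prod_sum_PiE) (simp_all add: power_sum)

lemma path_sum_eq:
  "(\<Sum>\<pi>\<in>motzkin_paths n. uvar ^ deg_theta \<pi> * vvar ^ deg_xi \<pi> * stair_q \<pi>) =
    (\<Sum>p\<in>mon_index n. uvar ^ deg_theta (fst p) * vvar ^ deg_xi (fst p) * qvar ^ (\<Sum>i=1..n. snd p i))"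
proof -
  have "stair_q \<pi> = (\<Sum>\<alpha>\<in>exponents n \<pi>. qvar ^ (\<Sum>i=1..n. \<alpha> i))" if "\<pi> \<in> motzkin_paths n" for \<pi>
    using that by (intro stair_q_eq) (simp add: motzkin_paths_def)
  then have "(\<Sum>\<pi>\<in>motzkin_paths n. uvar ^ deg_theta \<pi> * vvar ^ deg_xi \<pi> * stair_q \<pi>) =
    (\<Sum>\<pi>\<in>motzkin_paths n. \<Sum>\<alpha>\<in>exponents n \<pi>.
      uvar ^ deg_theta \<pi> * vvar ^ deg_xi \<pi> * qvar ^ (\<Sum>i=1..n. \<alpha> i))"
    by (simp add: sum_distrib_left)
  also have "\<dots> = (\<Sum>p\<in>mon_index n.
    uvar ^ deg_theta (fst p) * vvar ^ deg_xi (fst p) * qvar ^ (\<Sum>i=1..n. snd p i))"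
    unfolding mon_index_def
    by (subst sum.Sigma) (auto simp: finite_motzkin_paths finite_exponents case_prod_unfold)
  finally show ?thesis .
qed

text \<open>Each index pair contributes one monomial in the three variables, whose exponents are the
  tridegree of its word. Hence a coefficient counts index pairs.\<close>

lemma path_sum_nth:
  "fps_nth (fps_nth (fps_nth
    (\<Sum>\<pi>\<in>motzkin_paths n. uvar ^ deg_theta \<pi> * vvar ^ deg_xi \<pi> * stair_q \<pi>) c) b) a =
    int (card {p \<in> mon_index n. tri_deg (mon_word n p) = (a, b, c)})"
proof -
  have "fps_nth (fps_nth (fps_nth
    (\<Sum>\<pi>\<in>motzkin_paths n. uvar ^ deg_theta \<pi> * vvar ^ deg_xi \<pi> * stair_q \<pi>) c) b) a =
    (\<Sum>p\<in>mon_index n. of_bool (tri_deg (mon_word n p) = (a, b, c)))"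
    unfolding path_sum_eq by (simp add: fps_sum_nth qvar_power_nth tri_deg_mon_word)
  also have "\<dots> = int (card {p \<in> mon_index n. tri_deg (mon_word n p) = (a, b, c)})"
    using finite_mon_index by (simp add: of_bool_def sum.If_cases Int_def)
  finally show ?thesis .
qed

section \<open>The Hilbert series\<close>

text \<open>In the zero ring every span is already everything, so no vector can be independent of
  it. Here \<open>K\<close> is just a nonempty set of elements, because the scalars are known to
  form a subfield only after the ring is known to be nonzero.\<close>

lemma (in ring) independent_imp_one_not_zero:
  assumes "independent K Us" "Us \<noteq> []" "K \<noteq> {}" "K \<subseteq> carrier R"
  shows "\<one> \<noteq> \<zero>"
proof
  assume "\<one> = \<zero>"
  then have triv: "carrier R = {\<zero>}" by (rule one_zeroD)
  obtain u Vs where Us: "Us = u # Vs" using assms(2) by (cases Us) auto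
  have u: "u \<in> carrier R" "u \<notin> Span K Vs" and Vs: "set Vs \<subseteq> carrier R"
    using independent_backwards[OF assms(1)[unfolded Us]] independent_in_carrier by blast+
  have "Span K Vs \<noteq> {}"
  proof (induction Vs)
    case (Cons v Vs)
    then show ?case using assms(3) by (auto simp: line_extension_mem_iff ex_in_conv[symmetric])
  qed simp
  then have "Span K Vs = {\<zero>}"
    using Span_in_carrier[OF assms(4) Vs] triv subset_singletonD by metis
  with u triv show False by blast
qed

lemma mon_index_nonempty:
  assumes "n > 0"
  shows "mon_index n \<noteq> {}"
proof -
  \<comment> \<open>The witness has only up-steps and all exponents zero. Its height after
    \<open>i\<close> steps is \<open>i\<close>, and \<open>n > 0\<close> provides the required first
    step.\<close>
  let ?\<pi> = "replicate n Up"
  have "snd (sum_list (replicate i (1, 1) :: (int \<times> int) list)) = int i" for i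
    by (induction i) auto
  then have "snd (path_point ?\<pi> i) = int i" if "i \<le> n" for i
    using that by (simp add: path_point_def map_replicate_const min_def)
  then have "?\<pi> \<in> motzkin_paths n"
    using assms by (simp add: motzkin_paths_def)
  moreover have "T_set ?\<pi> = {}" "S_set ?\<pi> = {}"
    by (auto simp: T_set_def S_set_def)
  moreover have "stair_exp {} {} i \<ge> 0" for i
    by (induction "{} :: nat set" "{} :: nat set" i rule: stair_exp.induct) auto
  then have "(\<lambda>i\<in>{1..n}. 0) \<in> (\<Pi>\<^sub>E i\<in>{1..n}. {..<nat (stair_exp {} {} i + 1)})"
    by (auto simp: add_nonneg_pos)
  ultimately have "(?\<pi>, \<lambda>i\<in>{1..n}. 0) \<in> mon_index n"
    unfolding mon_index_def exponents_def by simp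
  then show ?thesis by blast
qed

text \<open>If two classes agree, the difference of the words lies in \<open>super_ideal\<close>,
  which is homogeneous for the multidegree. When the multidegrees differ, one word alone then lies
  in the ideal and maps to zero.\<close>

lemma inj_on_monomial_class:
  assumes "\<And>p. p \<in> P \<Longrightarrow> coinv_map n (word (w p)) \<noteq> \<zero>\<^bsub>coinv n\<^esub>"
    and w: "\<And>p. p \<in> P \<Longrightarrow> w p \<in> lists (vars n)"
    and inj: "inj_on (\<lambda>p. mset (w p)) P"
  shows "inj_on (\<lambda>p. super_class n (word (w p))) P"
proof (rule inj_onI, rule ccontr)
  fix p q assume p: "p \<in> P" and q: "q \<in> P" and "p \<noteq> q"
    and eq: "super_class n (word (w p)) = super_class n (word (w q))"
  then have ne: "mset (w q) \<noteq> mset (w p)" using inj by (metis inj_onD)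
  have c: "word (w p) \<in> carrier (free_alg n)" "word (w q) \<in> carrier (free_alg n)"
    using w p q word_closed by blast+
  have "(\<lambda>v. word (w p) v - word (w q) v) \<in> super_ideal n"
    using eq super_class_iff[OF c] by blast
  \<comment> \<open>Projecting to the multidegree of \<open>w p\<close> removes
    \<open>word (w q)\<close> and leaves \<open>word (w p)\<close>.\<close>
  from super_ideal_homogeneous[OF additive_mset this, of "mset (w p)"]
  have "word (w p) \<in> super_ideal n"
    using ne unfolding proj_diff proj_word[where n = n] by (simp add: free_alg_simps(4))
  then have "word (w p) \<in> coinv_kernel n" using super_ideal_subset_coinv_kernel by blast
  with assms(1)[OF p] show False by (simp add: coinv_kernel_def a_kernel_def')
qed

theorem proposition3p6:
  fixes n :: nat
  assumes "n > 0"
    and "image_is_basis n (B_set n)"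
  shows "Hilb n = (\<Sum>\<pi>\<in>motzkin_paths n. uvar ^ deg_theta \<pi> * vvar ^ deg_xi \<pi> * stair_q \<pi>)"
proof -
  interpret R: ring "coinv n" by (rule ring_coinv)
  let ?K = "coinv_scalars n" and ?I = "mon_index n"
  define g where "g p = super_class n (word (mon_word n p))" for p
  have B: "B_set n = g ` ?I" by (simp add: B_set_eq g_def)
  obtain bs where bs: "distinct bs" "set bs = B_set n"
    and indep: "R.independent ?K (map (coinv_class n) bs)"
    and span: "R.Span ?K (map (coinv_class n) bs) = carrier (coinv n)"
    using assms(2) by (auto simp: image_is_basis_def)
  have "?K \<noteq> {}" by (simp add: coinv_scalars_def)
  moreover have "?K \<subseteq> carrier (coinv n)"
    unfolding coinv_scalars_eq coinv_map_surj[symmetric] using const_closed by blast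
  \<comment> \<open>There is at least one basis monomial, and an independent nonempty list rules out
    the zero ring.\<close>
  moreover have "map (coinv_class n) bs \<noteq> []"
    using mon_index_nonempty[OF assms(1)] B bs(2) by auto
  ultimately have one: "\<one>\<^bsub>coinv n\<^esub> \<noteq> \<zero>\<^bsub>coinv n\<^esub>"
    using R.independent_imp_one_not_zero[OF indep] by blast
  \<comment> \<open>No basis vector is zero, which is what injectivity of the indexing
    \<open>g\<close> requires.\<close>
  have "\<zero>\<^bsub>coinv n\<^esub> \<notin> coinv_class n ` g ` ?I"
    using R.independent_nonzero[OF subfield_coinv_scalars[OF one] indep] bs(2) B by simp
  then have "inj_on g ?I"
    unfolding g_def
    by (intro inj_on_monomial_class set_mon_word inj_on_mset_mon_word)
      (auto simp: coinv_map_def image_iff)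
  \<comment> \<open>The basis comes as an enumeration \<open>bs\<close> in unspecified order.
    Pulling it back along \<open>g\<close> lists every index pair exactly once in the same
    order.\<close>
  define ps where "ps = map (inv_into ?I g) bs"
  have "distinct ps"
    using bs B by (simp add: ps_def distinct_map inj_on_inv_into)
  have "set ps = ?I"
    using \<open>inj_on g ?I\<close> by (simp add: ps_def bs(2) B image_image)
  have "map g ps = bs"
    unfolding ps_def map_map by (rule map_idI) (use bs(2) B in \<open>simp add: f_inv_into_f\<close>)
  \<comment> \<open>Replacing index pairs by words gives each basis vector a representative with a
    definite tridegree.\<close>
  define ws where "ws = map (mon_word n) ps"
  have ws: "map (coinv_class n) bs = map (\<lambda>w. coinv_map n (word w)) ws"
    unfolding \<open>map g ps = bs\<close>[symmetric] by (simp add: ws_def g_def coinv_map_def)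
  have "set ws \<subseteq> lists (vars n)"
    using set_mon_word \<open>set ps = ?I\<close> unfolding ws_def by auto
  then have "R.dim ?K (coinv_component n a b c) =
      card {p \<in> ?I. tri_deg (mon_word n p) = (a, b, c)}" for a b c
  proof -
    have "R.dim ?K (coinv_component n a b c) = length (filter (\<lambda>w. tri_deg w = (a, b, c)) ws)"
      using dim_coinv_component[OF one \<open>set ws \<subseteq> lists (vars n)\<close>] indep span unfolding ws by blast
    also have "\<dots> = length (filter (\<lambda>p. tri_deg (mon_word n p) = (a, b, c)) ps)"
      by (simp add: ws_def filter_map o_def)
    \<comment> \<open>As \<open>ps\<close> has no repetitions, the length of its filtered part is
      the number of index pairs of that tridegree.\<close>
    also have "\<dots> = card {p \<in> ?I. tri_deg (mon_word n p) = (a, b, c)}"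
      using \<open>distinct ps\<close> \<open>set ps = ?I\<close> by (simp add: distinct_length_filter Int_def conj_commute)
    finally show ?thesis .
  qed
  then show ?thesis
    unfolding Hilb_def by (intro fps_ext) (simp add: path_sum_nth)
qed

end
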